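(* Let $(Z,d)$ be a complete separable metric space and let $\eta$ be a Poisson point process on $Z$ with $\sigma$-finite intensity measure $\nu$, finite on balls. Then for every Borel set $A\subset\mathcal M_{\bar{\mathbb N}}(Z)$ and every $r\ge0$, $$\mathbb P(\eta\in A)\,\mathbb P(\eta\notin A_r^d)\le e^{-r^2/4},$$ where $A_r^d=\{\xi\in\mathcal M_{\bar{\mathbb N}}(Z):d_A(\xi)\le r\}$.
   Context: $\mathcal M_{\bar{\mathbb N}}(Z)$ is the space of locally finite configurations: Borel measures $\xi$ on $Z$ such that for every closed ball $B$, the restriction $\xi|_B$ is a finite sum of Dirac masses (repetitions allowed), with the vague topology (generated by $\xi\mapsto\int f\,d\xi$ for $f$ bounded continuous vanishing outside a ball). $\xi(x)$ means $\xi(\{x\})$, and $x\in\xi$ means $\xi(x)>0$. A Poisson point process with intensity $\nu$ is an $\mathcal M_{\bar{\mathbb N}}(Z)$-valued random variable $\eta$ such that for pairwise disjoint measurable $A_1,\dots,A_l$ with $\nu(A_i)<\infty$, the variables $\eta(A_1),\dots,\eta(A_l)$ are independent Poisson with means $\nu(A_1),\dots,\nu(A_l)$. For $\xi\in\mathcal M_{\bar{\mathbb N}}(Z)$, $\mathcal L^2(\xi)$ is the space of $g:Z\to\mathbb R$ with $g(x)=0$ whenever $\xi(x)=0$ and $|g|_{\mathcal L^2(\xi)}^2:=\sum_{x\in\xi}\xi(x)g(x)^2<\infty$. For $\xi,\chi\in\mathcal M_{\bar{\mathbb N}}(Z)$, $\xi\setminus\chi=\sum_{x\in\xi}(\xi(x)-\chi(x))_+\delta_x$.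 For $A\subset\mathcal M_{\bar{\mathbb N}}(Z)$, $$d_A(\xi)=\sup_{g}\ \inf_{\chi\in A}\int g\,d(\xi\setminus\chi),$$ the supremum being over all non-negative $g\in\mathcal L^2(\xi)$ with $|g|_{\mathcal L^2(\xi)}\le1$. *)

theory Defs
  imports "HOL-Probability.Probability"
begin

text \<open>The Dirac masses are listed with repetitions. Balls of negative radius are empty and impose
  no condition.\<close>

definition configurations :: "'a::metric_space measure set" where
  "configurations = {\<xi>. sets \<xi> = sets borel \<and>
     (\<forall>z R. \<exists>xs. \<forall>B\<in>sets borel.
        emeasure \<xi> (B \<inter> cball z R) = (\<Sum>x\<leftarrow>xs. emeasure (return borel x) B))}"

definition vague_test_functions :: "('a::metric_space \<Rightarrow> real) set" where
  "vague_test_functions = {f. continuous_on UNIV f \<and> bounded (range f) \<and>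
     (\<exists>z R. \<forall>x. x \<notin> cball z R \<longrightarrow> f x = 0)}"

definition vague_topology :: "'a::metric_space measure topology" where
  "vague_topology = topology_generated_by
     {{\<xi> \<in> configurations. (\<integral>x. f x \<partial>\<xi>) \<in> U} | f U. f \<in> vague_test_functions \<and> open U}"

definition configuration_space :: "'a::metric_space measure measure" where
  "configuration_space = sigma configurations {U. openin vague_topology U}"

text \<open>The library constant \<^verbatim>\<open>poisson_pmf\<close> is specified for positive rates only, whereas the mean
  may be 0 here; as \<^verbatim>\<open>0 ^ 0 = 1\<close>, the formula below then says that \<^verbatim>\<open>X = 0\<close> almost surely.
  The values of \<^verbatim>\<open>X\<close> lie in the extended half-line because \<^verbatim>\<open>\<eta>(A)\<close> can be infinite on a null set
  when \<^verbatim>\<open>A\<close> is unbounded.\<close>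

definition poisson_distributed :: "'w measure \<Rightarrow> ('w \<Rightarrow> ennreal) \<Rightarrow> real \<Rightarrow> bool" where
  "poisson_distributed M X m \<longleftrightarrow> X \<in> borel_measurable M \<and>
     (\<forall>k::nat. measure M {\<omega> \<in> space M. X \<omega> = of_nat k} = m ^ k / fact k * exp (- m))"

definition poisson_point_process ::
  "'w measure \<Rightarrow> 'a::metric_space measure \<Rightarrow> ('w \<Rightarrow> 'a measure) \<Rightarrow> bool" where
  "poisson_point_process M \<nu> \<eta> \<longleftrightarrow>
     \<eta> \<in> measurable M configuration_space \<and>
     (\<forall>(l::nat) A. (\<forall>i<l. A i \<in> sets borel \<and> emeasure \<nu> (A i) < \<infinity>) \<longrightarrow>
        disjoint_family_on A {..<l} \<longrightarrow>
        prob_space.indep_vars M (\<lambda>_. borel) (\<lambda>i \<omega>. emeasure (\<eta> \<omega>) (A i)) {..<l} \<and>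
        (\<forall>i<l. poisson_distributed M (\<lambda>\<omega>. emeasure (\<eta> \<omega>) (A i)) (measure \<nu> (A i))))"

definition atoms :: "'a measure \<Rightarrow> 'a set" where
  "atoms \<xi> = {x. emeasure \<xi> {x} > 0}"

definition L2_config :: "'a measure \<Rightarrow> ('a \<Rightarrow> real) set" where
  "L2_config \<xi> = {g. (\<forall>x. emeasure \<xi> {x} = 0 \<longrightarrow> g x = 0) \<and>
     (\<lambda>x. measure \<xi> {x} * (g x)\<^sup>2) summable_on atoms \<xi>}"

definition L2_config_norm :: "'a measure \<Rightarrow> ('a \<Rightarrow> real) \<Rightarrow> real" where
  "L2_config_norm \<xi> g = sqrt (\<Sum>\<^sub>\<infinity>x\<in>atoms \<xi>. measure \<xi> {x} * (g x)\<^sup>2)"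

text \<open>The sum of the masses \<^verbatim>\<open>(\<xi>(x) - \<zeta>(x))\<^sub>+ \<delta>\<^sub>x\<close> over the atoms of \<^verbatim>\<open>\<xi>\<close>, as a measure on the
  Borel sets: subtraction on \<^typ>\<open>ennreal\<close> is truncated at 0, and \<^const>\<open>distr\<close> along the identity
  merely restricts the sigma-algebra.\<close>

definition config_diff :: "'a::topological_space measure \<Rightarrow> 'a measure \<Rightarrow> 'a measure" where
  "config_diff \<xi> \<zeta> =
     distr (density (count_space (atoms \<xi>)) (\<lambda>x. emeasure \<xi> {x} - emeasure \<zeta> {x})) borel (\<lambda>x. x)"

text \<open>Values are in \<^typ>\<open>ennreal\<close>, since the integral of an \<^verbatim>\<open>L\<^sup>2\<close> function may be infinite;
  the distance to the empty set is infinite.\<close>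

definition convex_dist :: "'a::metric_space measure set \<Rightarrow> 'a measure \<Rightarrow> ennreal" where
  "convex_dist A \<xi> =
     (SUP g \<in> {g \<in> L2_config \<xi>. (\<forall>x. 0 \<le> g x) \<and> L2_config_norm \<xi> g \<le> 1}.
        INF \<zeta>\<in>A. \<integral>\<^sup>+x. ennreal (g x) \<partial>(config_diff \<xi> \<zeta>))"

definition convex_enlargement :: "'a::metric_space measure set \<Rightarrow> real \<Rightarrow> 'a measure set" where
  "convex_enlargement A r = {\<xi> \<in> configurations. convex_dist A \<xi> \<le> ennreal r}"

end

theory Submission
  imports Defs
begin

text \<open>Talagrand's inductive proof gives the inequality for independent Bernoulli variables, with a one-sided
  convex distance. Sums of Bernoulli variables turn it into an inequality for independent binomial counts,
  and in the limit for independent Poisson counts, in particular for the numbers of points of \<open>\<eta>\<close> in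
  finitely many disjoint cells.

  To pass to arbitrarily fine cells exhausting the space, \<open>A\<close> is replaced by a subset \<open>A'\<close> of nearly the same
  probability such that every sequence in \<open>A'\<close> has a subsequence converging to an element of \<open>A\<close>, in
  the sense that the number of points in each set of a countable basis, cut off by a ball, converges. For
  this, a configuration is encoded by these countably many numbers: the vague Borel sets are preimages of
  Borel sets of a product of lines, where probabilities are inner regular, and the points may be assumed
  to lie in compact parts of the annuli around a centre on which the basis sets are relatively closed.
  By this compactness, if \<open>d\<^sub>A(\<xi>) > r\<close>, then the discretised distance of \<open>\<xi>\<close> to \<open>A'\<close> exceeds \<open>r\<close> for
  all sufficiently fine cells, and Fatou's lemma for sets concludes. Monotonicity in \<open>A\<close> and the measurable
  lower limit of the discretised events make the measurability of \<open>d\<^sub>A\<close> irrelevant.\<close>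

section \<open>Talagrand's inequality for Bernoulli and Poisson variables\<close>

text \<open>One-sidedness is what survives the Poisson limit. Splitting a count of mean
  \<open>m\<close> into \<open>n\<close> Bernoulli variables of parameter \<open>m / n\<close> makes
  the dimension explode, but the cost \<open>sum g (S - T)\<close> and the norm of \<open>g\<close>
  over \<open>S\<close> involve only the coordinates equal to 1, that is, the points present. A
  weight constant along the variables of one cell has squared norm count times weight squared, the
  discrete form of \<open>L2_config_norm\<close>.

  The delicate direction is from cells back to points. A configuration may have more mass in a cell
  than at the atom of \<open>\<xi>\<close> inside it, so discretisation can lower the distance, and
  with infinitely many competitors no single partition need repair this. Failure at arbitrarily fine
  levels yields a sequence of competitors, and only a limit of theirs in \<open>A\<close> gives a
  contradiction. Counts on open sets can jump in such a limit; hence the confinement to sets on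
  which every \<open>V i\<close> is relatively open and closed.

  The constant 1/4 is tied to the two-point step: it makes the minimum over \<open>l\<close> of
  exp((1 - l)^2 / 4) times r^(-l) at most 2 - r, and x (2 - x) \<le> 1 closes the induction.\<close>

text \<open>The left side is the minimum over \<open>l\<close> of
  \<open>(1 - l)\<^sup>2 / 4 - l * ln r\<close>, attained at \<open>l = 1 + 2 * ln r\<close>. Both
  sides agree at \<open>r = 1\<close>, and the factor \<open>(1 - x) / (2 - x) + ln x\<close> in the
  derivative of \<open>f\<close> is nonpositive because \<open>ln x \<le> x - 1\<close>.\<close>

lemma ln_two_minus_bound:
  fixes r :: real
  assumes "0 < r" "r \<le> 1"
  shows "- ln r - (ln r)\<^sup>2 \<le> ln (2 - r)"
proof -
  define f where "f = (\<lambda>x::real. ln (2 - x) + ln x + (ln x)\<^sup>2)"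
  have "f 1 \<le> f r"
  proof (rule DERIV_nonpos_imp_nonincreasing[OF assms(2)])
    fix x :: real assume x: "r \<le> x" "x \<le> 1"
    then have x0: "0 < x" "0 < 2 - x" using assms by auto
    have d: "(f has_real_derivative (- 1 / (2 - x) + 1 / x + 2 * ln x * (1 / x))) (at x)"
      unfolding f_def using x0 by (auto intro!: derivative_eq_intros)
    have "ln x \<le> x - 1" using ln_le_minus_one x0(1) .
    moreover have "(1 - x) / (2 - x) \<le> (1 - x) / 1"
      using x x0 by (intro divide_left_mono) auto
    ultimately have neg: "(1 - x) / (2 - x) + ln x \<le> 0" by simp
    have "- 1 / (2 - x) + 1 / x + 2 * ln x * (1 / x)
        = 2 / x * ((1 - x) / (2 - x) + ln x)"
      using x0 by (simp add: divide_simps)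
    moreover have "2 / x * ((1 - x) / (2 - x) + ln x) \<le> 0"
      using neg x0(1) by (intro mult_nonneg_nonpos) auto
    ultimately have "- 1 / (2 - x) + 1 / x + 2 * ln x * (1 / x) \<le> 0" by simp
    with d show "\<exists>y. (f has_real_derivative y) (at x) \<and> y \<le> 0" by blast
  qed
  then show ?thesis by (simp add: f_def)
qed

text \<open>The unconstrained minimiser \<open>1 + 2 * ln r\<close> lies in the unit interval
  exactly when \<open>ln r \<ge> - 1 / 2\<close>. For smaller \<open>r\<close> the exponent
  increases with \<open>l\<close> on that interval, so the end point \<open>l = 0\<close> is
  taken.\<close>

lemma talagrand_exponent:
  fixes r :: real
  assumes "0 < r" "r \<le> 1"
  obtains l where "0 \<le> l" "l \<le> 1" "exp ((1 - l)\<^sup>2 / 4 - l * ln r) \<le> 2 - r"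
proof (cases "- 1 / 2 \<le> ln r")
  case True
  let ?l = "1 + 2 * ln r"
  have "(1 - ?l)\<^sup>2 / 4 - ?l * ln r = - ln r - (ln r)\<^sup>2"
    by (simp add: power2_eq_square algebra_simps)
  also have "\<dots> \<le> ln (2 - r)" using ln_two_minus_bound assms .
  finally have "exp ((1 - ?l)\<^sup>2 / 4 - ?l * ln r) \<le> exp (ln (2 - r))" by simp
  also have "\<dots> = 2 - r" using assms by simp
  finally show ?thesis using True assms by (intro that[of ?l]) auto
next
  \<comment> \<open>At \<open>l = 0\<close> the claim reads exp(1/4) \<le> 2 - r. From exp(1/4)
    \<ge> 5/4 follows r < exp(-1/2) \<le> 16/25, and 34/25 is 2 - 16/25.\<close>
  case False
  then have "r < exp (- 1 / 2)" using assms
    by (metis exp_less_mono exp_ln not_le)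
  moreover have "exp (- 1 / 2 :: real) = 1 / exp (1 / 4) ^ 2"
    by (simp add: exp_minus inverse_eq_divide flip: exp_of_nat_mult)
  moreover have q: "5 / 4 \<le> exp (1 / 4 :: real)" using exp_ge_add_one_self[of "1/4::real"] by simp
  then have "1 / exp (1 / 4 :: real) ^ 2 \<le> 1 / (5 / 4) ^ 2"
    by (intro divide_left_mono power_mono) auto
  ultimately have r: "r \<le> 16 / 25" by (simp add: power2_eq_square)
  have "exp (1/4::real) ^ 4 = exp 1" by (simp flip: exp_of_nat_mult)
  also have "\<dots> < (34 / 25) ^ 4" using e_less_272 by (simp add: eval_nat_numeral)
  finally have "exp (1/4::real) < 34 / 25" by (rule power_less_imp_less_base) simp
  then show ?thesis using r by (intro that[of 0]) auto
qed

section \<open>Talagrand's induction for product Bernoulli measures\<close>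

text \<open>For \<open>S \<subseteq> J\<close>, the probability that exactly the coordinates in
  \<open>S\<close> equal 1, for independent Bernoulli variables with parameters
  \<open>p j\<close>.\<close>

definition bern_weight :: "('j \<Rightarrow> real) \<Rightarrow> 'j set \<Rightarrow> 'j set \<Rightarrow> real" where
  "bern_weight p J S = (\<Prod>j\<in>J. if j \<in> S then p j else 1 - p j)"

text \<open>Here \<open>sum g (S - T)\<close> is a weighted one-sided Hamming distance of 0/1 vectors \<open>S\<close> and \<open>T\<close>. The condition
  says that \<open>v\<close> dominates a point of the convex hull of the vectors \<open>indicator (S - T)\<close>, \<open>T \<in> \<A>\<close>; the dual
  formulation avoids both the hull and the minimax theorem.\<close>

definition hull_dominating :: "'j set set \<Rightarrow> 'j set \<Rightarrow> ('j \<Rightarrow> real) \<Rightarrow> bool" where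
  "hull_dominating \<A> S v \<longleftrightarrow> (\<forall>g. (\<forall>j. 0 \<le> g j) \<longrightarrow> (\<exists>T\<in>\<A>. sum g (S - T) \<le> (\<Sum>j\<in>S. g j * v j)))"

lemma bern_weight_nonneg:
  assumes "\<And>j. 0 \<le> p j" "\<And>j. p j \<le> 1"
  shows "0 \<le> bern_weight p J S"
  unfolding bern_weight_def using assms by (intro prod_nonneg) auto

lemma bern_weight_insert:
  assumes "finite J" "a \<notin> J" "S \<subseteq> J"
  shows "bern_weight p (insert a J) S = (1 - p a) * bern_weight p J S"
    and "bern_weight p (insert a J) (insert a S) = p a * bern_weight p J S"
proof -
  have "a \<notin> S" using assms by auto
  then show "bern_weight p (insert a J) S = (1 - p a) * bern_weight p J S"
    using assms by (simp add: bern_weight_def)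
  have "(\<Prod>j\<in>J. if j \<in> insert a S then p j else 1 - p j) = (\<Prod>j\<in>J. if j \<in> S then p j else 1 - p j)"
    using assms by (intro prod.cong) auto
  then show "bern_weight p (insert a J) (insert a S) = p a * bern_weight p J S"
    using assms by (simp add: bern_weight_def)
qed

lemma sum_Pow_insert:
  fixes f :: "'j set \<Rightarrow> real"
  assumes "finite J" "a \<notin> J"
  shows "sum f (Pow (insert a J)) = (\<Sum>S\<in>Pow J. f S + f (insert a S))"
proof -
  have "sum f (Pow (insert a J)) = sum f (Pow J) + sum f (insert a ` Pow J)"
    unfolding Pow_insert using assms by (intro sum.union_disjoint) auto
  also have "sum f (insert a ` Pow J) = (\<Sum>S\<in>Pow J. f (insert a S))"
    using assms(2) by (subst sum.reindex) (auto simp: inj_on_def insert_ident subset_iff)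
  finally show ?thesis by (simp add: sum.distrib)
qed

text \<open>Each weight \<open>g\<close> has two candidates in \<open>\<C>\<close>:
  \<open>insert a T\<close>, which covers \<open>a\<close> and costs at most the
  \<open>u\<close>-sum, and a lift of \<open>T'\<close>, which may miss \<open>a\<close> and costs
  at most the \<open>v\<close>-sum plus \<open>g a\<close>. The right side averages these two bounds
  with weights \<open>l\<close> and \<open>1 - l\<close>, so one candidate stays below it. Only the
  second can pay for \<open>a\<close>, hence the entry \<open>1 - l\<close>.\<close>

lemma hull_dominating_mix:
  assumes "hull_dominating \<A> S u" "hull_dominating \<B> S v" "0 \<le> l" "l \<le> 1" "finite S" "a \<notin> S"
    and A: "\<And>T. T \<in> \<A> \<Longrightarrow> insert a T \<in> \<C>"
    and B: "\<And>T. T \<in> \<B> \<Longrightarrow> \<exists>T'\<in>\<C>. T' - {a} = T - {a}"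
  shows "hull_dominating \<C> (insert a S) ((\<lambda>j. l * u j + (1 - l) * v j)(a := 1 - l))"
  unfolding hull_dominating_def
proof (intro allI impI)
  fix g :: "'a \<Rightarrow> real" assume g: "\<forall>j. 0 \<le> g j"
  obtain T where T: "T \<in> \<A>" "sum g (S - T) \<le> (\<Sum>j\<in>S. g j * u j)"
    using assms(1) g unfolding hull_dominating_def by blast
  obtain T' where T': "T' \<in> \<B>" "sum g (S - T') \<le> (\<Sum>j\<in>S. g j * v j)"
    using assms(2) g unfolding hull_dominating_def by blast
  obtain U where U: "U \<in> \<C>" "U - {a} = T' - {a}" using B T'(1) by blast
  have c1: "sum g (insert a S - insert a T) \<le> (\<Sum>j\<in>S. g j * u j)"
  proof -
    have "insert a S - insert a T = S - T" using \<open>a \<notin> S\<close> by auto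
    then show ?thesis using T by simp
  qed
  have c2: "sum g (insert a S - U) \<le> (\<Sum>j\<in>S. g j * v j) + g a"
  proof -
    have "insert a S - U \<subseteq> insert a (S - T')" using U(2) \<open>a \<notin> S\<close> by auto
    then have "sum g (insert a S - U) \<le> sum g (insert a (S - T'))"
      using \<open>finite S\<close> g by (intro sum_mono2) auto
    also have "\<dots> = g a + sum g (S - T')" using \<open>finite S\<close> \<open>a \<notin> S\<close> by simp
    finally show ?thesis using T' by simp
  qed
  let ?w = "(\<lambda>j. l * u j + (1 - l) * v j)(a := 1 - l)"
  have rhs: "(\<Sum>j\<in>insert a S. g j * ?w j)
     = l * (\<Sum>j\<in>S. g j * u j) + (1 - l) * ((\<Sum>j\<in>S. g j * v j) + g a)"
  proof -
    have "(\<Sum>j\<in>insert a S. g j * ?w j) = g a * (1 - l) + (\<Sum>j\<in>S. g j * ?w j)"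
      using \<open>finite S\<close> \<open>a \<notin> S\<close> by simp
    also have "(\<Sum>j\<in>S. g j * ?w j) = (\<Sum>j\<in>S. l * (g j * u j) + (1 - l) * (g j * v j))"
      using \<open>a \<notin> S\<close> by (intro sum.cong) (auto simp: algebra_simps)
    also have "\<dots> = l * (\<Sum>j\<in>S. g j * u j) + (1 - l) * (\<Sum>j\<in>S. g j * v j)"
      by (simp add: sum.distrib sum_distrib_left)
    finally show ?thesis by (simp add: algebra_simps)
  qed
  show "\<exists>T\<in>\<C>. sum g (insert a S - T) \<le> (\<Sum>j\<in>insert a S. g j * ?w j)"
  proof (rule ccontr)
    assume "\<not> ?thesis"
    then have n: "\<And>T. T \<in> \<C> \<Longrightarrow> (\<Sum>j\<in>insert a S. g j * ?w j) < sum g (insert a S - T)"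
      by (auto simp: not_le)
    let ?R = "(\<Sum>j\<in>insert a S. g j * ?w j)"
    have a: "?R < (\<Sum>j\<in>S. g j * u j)" using n[OF A[OF T(1)]] c1 by simp
    have b: "?R < (\<Sum>j\<in>S. g j * v j) + g a" using n[OF U(1)] c2 by simp
    have "?R = l * ?R + (1 - l) * ?R" by (simp add: algebra_simps)
    also have "\<dots> < l * (\<Sum>j\<in>S. g j * u j) + (1 - l) * ((\<Sum>j\<in>S. g j * v j) + g a)"
    proof (cases "l = 0")
      case True then show ?thesis using b by simp
    next
      case False
      then show ?thesis using a b assms(3,4)
        by (intro add_less_le_mono mult_strict_left_mono mult_left_mono) auto
    qed
    finally show False using rhs by simp
  qed
qed

text \<open>A pointwise Young inequality in the role of Hoelder's: if \<open>exp s\<close> and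
  \<open>exp t\<close> have means at most \<open>\<alpha>\<close> and \<open>\<beta>\<close>, the
  last factor averages to at most 1, leaving the geometric mean of \<open>\<alpha>\<close> and
  \<open>\<beta>\<close>. It is convexity of exp at \<open>s - ln \<alpha>\<close> and
  \<open>t - ln \<beta>\<close>.\<close>

lemma exp_mix_le:
  fixes s t \<alpha> \<beta> :: real
  assumes "0 < \<alpha>" "0 < \<beta>" "0 \<le> l" "l \<le> 1"
  shows "exp (l * s + (1 - l) * t) \<le>
    exp (l * ln \<alpha> + (1 - l) * ln \<beta>) * (l * (exp s / \<alpha>) + (1 - l) * (exp t / \<beta>))"
proof -
  have "exp ((1 - l) * (t - ln \<beta>) + l * (s - ln \<alpha>)) \<le> (1 - l) * exp (t - ln \<beta>) + l * exp (s - ln \<alpha>)"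
    using convex_onD[OF exp_convex, of l "t - ln \<beta>" "s - ln \<alpha>"] assms by simp
  also have "\<dots> = l * (exp s / \<alpha>) + (1 - l) * (exp t / \<beta>)" using assms by (simp add: exp_diff)
  finally have *: "exp ((1 - l) * (t - ln \<beta>) + l * (s - ln \<alpha>)) \<le> l * (exp s / \<alpha>) + (1 - l) * (exp t / \<beta>)" .
  have "exp (l * s + (1 - l) * t) = exp (l * ln \<alpha> + (1 - l) * ln \<beta>) * exp ((1 - l) * (t - ln \<beta>) + l * (s - ln \<alpha>))"
    by (simp flip: exp_add) (simp add: algebra_simps)
  also have "\<dots> \<le> exp (l * ln \<alpha> + (1 - l) * ln \<beta>) * (l * (exp s / \<alpha>) + (1 - l) * (exp t / \<beta>))"
    using * by (intro mult_left_mono) auto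
  finally show ?thesis .
qed

lemma mix_square_le:
  fixes u v l :: real
  assumes "0 \<le> l" "l \<le> 1"
  shows "(l * u + (1 - l) * v)\<^sup>2 \<le> l * u\<^sup>2 + (1 - l) * v\<^sup>2"
proof -
  have "l * u\<^sup>2 + (1 - l) * v\<^sup>2 - (l * u + (1 - l) * v)\<^sup>2 = l * (1 - l) * (u - v)\<^sup>2"
    by (simp add: power2_eq_square algebra_simps)
  moreover have "0 \<le> l * (1 - l) * (u - v)\<^sup>2" using assms by simp
  ultimately show ?thesis by linarith
qed

text \<open>With \<open>v S\<close> a hull vector chosen for every \<open>S\<close>, this dominates
  Talagrand's expectation of exp(d^2 / 4), where d is the least norm of such a vector. The squares
  are summed over \<open>S\<close> only.\<close>

definition exp_mean :: "('j \<Rightarrow> real) \<Rightarrow> 'j set \<Rightarrow> ('j set \<Rightarrow> 'j \<Rightarrow> real) \<Rightarrow> real" where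
  "exp_mean p J v = (\<Sum>S\<in>Pow J. bern_weight p J S * exp ((\<Sum>j\<in>S. (v S j)\<^sup>2) / 4))"

text \<open>The inequality \<open>x * (2 - x) \<le> 1\<close>, where \<open>x\<close> is the ratio of the masses of \<open>\<A>\<close> and \<open>\<B>\<close>.\<close>

lemma talagrand_combine:
  fixes a b :: real
  assumes "0 < b"
  shows "a * (1 / b * (2 - a / b)) \<le> 1"
proof -
  have "1 - a * (1 / b * (2 - a / b)) = (1 - a / b)\<^sup>2"
    using assms by (simp add: power2_eq_square field_simps)
  then show ?thesis by (metis diff_ge_0_iff_ge zero_le_power2)
qed

lemma talagrand_average:
  fixes p b x y :: real
  shows "(1 - p) * (1 / b * (2 - x / b)) + p * (1 / b * (2 - y / b)) = 1 / b * (2 - (p * y + (1 - p) * x) / b)"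
proof -
  have "(1 - p) * (1 / b * (2 - x / b)) + p * (1 / b * (2 - y / b))
    = 1 / b * ((1 - p) * (2 - x / b) + p * (2 - y / b))" by algebra
  also have "(1 - p) * (2 - x / b) + p * (2 - y / b) = 2 - (p * y + (1 - p) * x) / b"
    by (cases "b = 0") (simp_all add: field_simps)
  finally show ?thesis .
qed

text \<open>Induction step for the vectors containing the new coordinate \<open>a\<close>: mix, with a weight \<open>l\<close>, a hull vector
  for the section \<open>\<A>1\<close> at \<open>a\<close>, at no cost in the coordinate \<open>a\<close>, with one for the projection \<open>\<B>\<close>, at cost 1.\<close>

lemma talagrand_upper_section:
  assumes "finite J" "a \<notin> J" and p: "\<And>j. 0 < p j" "\<And>j. p j < 1"
    and sub: "\<A>1 \<subseteq> \<B>" "\<B> \<subseteq> Pow J" "\<B> \<noteq> {}"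
    and A: "\<And>T. T \<in> \<A>1 \<Longrightarrow> insert a T \<in> \<C>"
    and B: "\<And>T. T \<in> \<B> \<Longrightarrow> \<exists>T'\<in>\<C>. T' - {a} = T - {a}"
    and IH: "\<And>\<A>. \<A> \<subseteq> Pow J \<Longrightarrow> \<A> \<noteq> {} \<Longrightarrow> \<exists>v. (\<forall>S\<subseteq>J. hull_dominating \<A> S (v S)) \<and>
      sum (bern_weight p J) \<A> * exp_mean p J v \<le> 1"
  defines "m \<equiv> sum (bern_weight p J)"
  shows "\<exists>w. (\<forall>S\<subseteq>J. hull_dominating \<C> (insert a S) (w S)) \<and>
    (\<Sum>S\<in>Pow J. bern_weight p J S * exp ((\<Sum>j\<in>insert a S. (w S j)\<^sup>2) / 4)) \<le> 1 / m \<B> * (2 - m \<A>1 / m \<B>)"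
proof -
  have wpos: "0 < bern_weight p J S" for S
    unfolding bern_weight_def using p by (intro prod_pos) auto
  have finB: "finite \<B>" using sub(2) \<open>finite J\<close> by (meson finite_Pow_iff finite_subset)
  have mB: "0 < m \<B>" unfolding m_def using wpos finB sub(3) by (intro sum_pos) auto
  obtain v where v: "\<And>S. S \<subseteq> J \<Longrightarrow> hull_dominating \<B> S (v S)" "m \<B> * exp_mean p J v \<le> 1"
    using IH[OF sub(2,3)] unfolding m_def by auto
  have v': "exp_mean p J v \<le> 1 / m \<B>" using v(2) mB by (simp add: field_simps)
  \<comment> \<open>The disjunct \<open>l = 0\<close> covers an empty section: it has no hull
    vector, so all weight goes to \<open>\<B>\<close>. The factor in front of the sum is the price
    of the entry \<open>1 - l\<close> at \<open>a\<close>.\<close>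
  obtain u l where u: "\<And>S. S \<subseteq> J \<Longrightarrow> l = 0 \<or> hull_dominating \<A>1 S (u S)"
    and l: "0 \<le> l" "l \<le> 1"
    and bound: "exp ((1 - l)\<^sup>2 / 4) * (\<Sum>S\<in>Pow J. bern_weight p J S *
       exp (l * ((\<Sum>j\<in>S. (u S j)\<^sup>2) / 4) + (1 - l) * ((\<Sum>j\<in>S. (v S j)\<^sup>2) / 4)))
       \<le> 1 / m \<B> * (2 - m \<A>1 / m \<B>)"
  proof (cases "\<A>1 = {}")
    case True
    \<comment> \<open>Here \<open>m \<A>1 = 0\<close>, so at \<open>l = 0\<close> the bound only
      asks for exp(1/4) \<le> 2.\<close>
    have "exp (1/4::real) ^ 4 = exp 1" by (simp flip: exp_of_nat_mult)
    also have "\<dots> < 2 ^ 4" using e_less_272 by (simp add: eval_nat_numeral)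
    finally have e: "exp (1/4::real) < 2" by (rule power_less_imp_less_base) simp
    have "exp (1 / 4) * exp_mean p J v \<le> 2 * (1 / m \<B>)"
      using v' e by (intro mult_mono) (auto simp: exp_mean_def intro!: sum_nonneg mult_nonneg_nonneg less_imp_le[OF wpos])
    moreover have "m \<A>1 = 0" using True by (simp add: m_def)
    ultimately show ?thesis using True by (intro that[of 0 v]) (auto simp: exp_mean_def)
  next
    case False
    have finA: "finite \<A>1" using finB sub(1) finite_subset by blast
    have mA: "0 < m \<A>1" unfolding m_def using wpos finA False by (intro sum_pos) auto
    have mAB: "m \<A>1 \<le> m \<B>" unfolding m_def using finB sub(1) less_imp_le[OF wpos] by (intro sum_mono2) auto
    obtain u where u: "\<And>S. S \<subseteq> J \<Longrightarrow> hull_dominating \<A>1 S (u S)" "m \<A>1 * exp_mean p J u \<le> 1"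
      using IH[of \<A>1] order_trans[OF sub(1,2)] False unfolding m_def by blast
    have u': "exp_mean p J u \<le> 1 / m \<A>1" using u(2) mA by (simp add: field_simps)
    obtain l where l: "0 \<le> l" "l \<le> 1" "exp ((1 - l)\<^sup>2 / 4 - l * ln (m \<A>1 / m \<B>)) \<le> 2 - m \<A>1 / m \<B>"
      using talagrand_exponent[of "m \<A>1 / m \<B>"] mA mB mAB by auto
    \<comment> \<open>By induction \<open>?\<alpha>\<close> and \<open>?\<beta>\<close> bound the
      two exponential means, so \<open>exp_mix_le\<close> averages to at most \<open>?c\<close>.
      What remains is \<open>?\<beta>\<close> times the exponential for which \<open>l\<close> was
      chosen.\<close>
    let ?\<alpha> = "1 / m \<A>1" and ?\<beta> = "1 / m \<B>"
    let ?U = "\<lambda>S. (\<Sum>j\<in>S. (u S j)\<^sup>2) / 4" and ?V = "\<lambda>S. (\<Sum>j\<in>S. (v S j)\<^sup>2) / 4"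
    let ?c = "exp (l * ln ?\<alpha> + (1 - l) * ln ?\<beta>)"
    have "(\<Sum>S\<in>Pow J. bern_weight p J S * exp (l * ?U S + (1 - l) * ?V S))
        \<le> (\<Sum>S\<in>Pow J. bern_weight p J S * (?c * (l * (exp (?U S) / ?\<alpha>) + (1 - l) * (exp (?V S) / ?\<beta>))))"
      using mA mB l by (intro sum_mono mult_left_mono exp_mix_le) (auto intro: less_imp_le[OF wpos])
    also have "\<dots> = ?c * (l * (exp_mean p J u / ?\<alpha>) + (1 - l) * (exp_mean p J v / ?\<beta>))"
      unfolding exp_mean_def sum_divide_distrib sum_distrib_left sum.distrib[symmetric]
      by (intro sum.cong) (auto simp: algebra_simps)
    also have "\<dots> \<le> ?c * (l * 1 + (1 - l) * 1)"
      using u' v' mA mB l by (intro mult_left_mono add_mono) (auto simp: field_simps)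
    also have "\<dots> = ?c" by simp
    finally have "exp ((1 - l)\<^sup>2 / 4) * (\<Sum>S\<in>Pow J. bern_weight p J S * exp (l * ?U S + (1 - l) * ?V S))
        \<le> exp ((1 - l)\<^sup>2 / 4) * ?c" by simp
    also have "\<dots> = ?\<beta> * exp ((1 - l)\<^sup>2 / 4 - l * ln (m \<A>1 / m \<B>))"
    proof -
      have "?\<beta> * exp ((1 - l)\<^sup>2 / 4 - l * ln (m \<A>1 / m \<B>))
          = exp (- ln (m \<B>)) * exp ((1 - l)\<^sup>2 / 4 - l * (ln (m \<A>1) - ln (m \<B>)))"
        using mA mB by (simp add: exp_minus ln_div inverse_eq_divide)
      also have "\<dots> = exp ((1 - l)\<^sup>2 / 4) * exp (l * (- ln (m \<A>1)) + (1 - l) * (- ln (m \<B>)))"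
        unfolding exp_add[symmetric] by (simp add: algebra_simps)
      also have "\<dots> = exp ((1 - l)\<^sup>2 / 4) * ?c"
        using mA mB by (simp add: ln_div)
      finally show ?thesis by simp
    qed
    also have "\<dots> \<le> ?\<beta> * (2 - m \<A>1 / m \<B>)" using l(3) mB by (intro mult_left_mono) auto
    finally show ?thesis using u l by (intro that[of l u]) auto
  qed
  let ?w = "\<lambda>S. (\<lambda>j. l * u S j + (1 - l) * v S j)(a := 1 - l)"
  have "hull_dominating \<C> (insert a S) (?w S)" if "S \<subseteq> J" for S
  proof -
    have fS: "finite S" "a \<notin> S" using that assms(1,2) finite_subset by auto
    show ?thesis
    proof (cases "l = 0")
      case False
      then show ?thesis
        using hull_dominating_mix[OF _ v(1)[OF that] l fS A B] u[OF that] by auto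
    next
      \<comment> \<open>Lifting from \<open>\<B>\<close> alone may cost the full \<open>g a\<close>,
        in agreement with the entry 1 at \<open>a\<close>; the section need not have a hull vector
        here.\<close>
      case True
      show ?thesis unfolding hull_dominating_def
      proof (intro allI impI)
        fix g :: "'a \<Rightarrow> real" assume g: "\<forall>j. 0 \<le> g j"
        obtain T where T: "T \<in> \<B>" "sum g (S - T) \<le> (\<Sum>j\<in>S. g j * v S j)"
          using v(1)[OF \<open>S \<subseteq> J\<close>] g unfolding hull_dominating_def by blast
        obtain U where U: "U \<in> \<C>" "U - {a} = T - {a}" using B T(1) by blast
        have "sum g (insert a S - U) \<le> sum g (insert a (S - T))"
          using fS g U(2) by (intro sum_mono2) auto
        also have "\<dots> = g a + sum g (S - T)" using fS by simp
        also have "\<dots> \<le> g a + (\<Sum>j\<in>S. g j * ?w S j)"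
        proof -
          have "(\<Sum>j\<in>S. g j * ?w S j) = (\<Sum>j\<in>S. g j * v S j)"
            using fS True by (intro sum.cong) auto
          then show ?thesis using T(2) by simp
        qed
        also have "\<dots> = (\<Sum>j\<in>insert a S. g j * ?w S j)" using fS True by simp
        finally show "\<exists>T\<in>\<C>. sum g (insert a S - T) \<le> (\<Sum>j\<in>insert a S. g j * ?w S j)"
          using U(1) by blast
      qed
    qed
  qed
  moreover have "(\<Sum>S\<in>Pow J. bern_weight p J S * exp ((\<Sum>j\<in>insert a S. (?w S j)\<^sup>2) / 4))
      \<le> 1 / m \<B> * (2 - m \<A>1 / m \<B>)"
  proof (rule order_trans[OF _ bound], unfold sum_distrib_left, intro sum_mono)
    fix S assume "S \<in> Pow J"
    then have fS: "finite S" "a \<notin> S" using assms(1,2) finite_subset by auto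
    have "(\<Sum>j\<in>insert a S. (?w S j)\<^sup>2) = (1 - l)\<^sup>2 + (\<Sum>j\<in>S. (l * u S j + (1 - l) * v S j)\<^sup>2)"
    proof -
      have "(\<Sum>j\<in>S. (?w S j)\<^sup>2) = (\<Sum>j\<in>S. (l * u S j + (1 - l) * v S j)\<^sup>2)"
        using fS by (intro sum.cong) auto
      then show ?thesis using fS by simp
    qed
    also have "\<dots> \<le> (1 - l)\<^sup>2 + (\<Sum>j\<in>S. l * (u S j)\<^sup>2 + (1 - l) * (v S j)\<^sup>2)"
      using l by (intro add_left_mono sum_mono mix_square_le)
    also have "\<dots> = (1 - l)\<^sup>2 + (l * (\<Sum>j\<in>S. (u S j)\<^sup>2) + (1 - l) * (\<Sum>j\<in>S. (v S j)\<^sup>2))"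
      by (simp add: sum.distrib sum_distrib_left)
    finally have "exp ((\<Sum>j\<in>insert a S. (?w S j)\<^sup>2) / 4)
       \<le> exp ((1 - l)\<^sup>2 / 4 + (l * ((\<Sum>j\<in>S. (u S j)\<^sup>2) / 4) + (1 - l) * ((\<Sum>j\<in>S. (v S j)\<^sup>2) / 4)))"
      by simp
    then show "bern_weight p J S * exp ((\<Sum>j\<in>insert a S. (?w S j)\<^sup>2) / 4)
       \<le> exp ((1 - l)\<^sup>2 / 4) * (bern_weight p J S *
          exp (l * ((\<Sum>j\<in>S. (u S j)\<^sup>2) / 4) + (1 - l) * ((\<Sum>j\<in>S. (v S j)\<^sup>2) / 4)))"
      using mult_left_mono[OF _ less_imp_le[OF wpos]] unfolding exp_add by (simp add: mult.left_commute)
  qed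
  ultimately show ?thesis by (intro exI[of _ ?w] conjI allI impI)
qed

text \<open>Induction on \<open>J\<close>, with \<open>\<A>\<close> compared to its projection
  \<open>\<A>1 \<union> \<A>0\<close> along the new coordinate \<open>a\<close>. If
  \<open>a \<notin> S\<close>, whether \<open>a\<close> belongs to \<open>T\<close> does not affect
  \<open>S - T\<close>, so the hull vector of the projection also serves \<open>\<A>\<close>; this
  is where one-sidedness enters. If \<open>a \<in> S\<close>, \<open>talagrand_upper_section\<close>
  supplies the vector.\<close>

lemma talagrand_bernoulli:
  assumes "finite J" and p: "\<And>j. 0 < p j" "\<And>j. p j < 1"
    and "\<A> \<subseteq> Pow J" "\<A> \<noteq> {}"
  shows "\<exists>v. (\<forall>S\<subseteq>J. hull_dominating \<A> S (v S)) \<and> sum (bern_weight p J) \<A> * exp_mean p J v \<le> 1"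
  using assms(1,4,5)
proof (induction J arbitrary: \<A>)
  case empty
  then have "\<A> = {{}}" by auto
  then show ?case by (auto simp: hull_dominating_def bern_weight_def exp_mean_def)
next
  case (insert a J)
  define \<A>1 where "\<A>1 = {T. T \<subseteq> J \<and> insert a T \<in> \<A>}"
  define \<A>0 where "\<A>0 = {T. T \<subseteq> J \<and> T \<in> \<A>}"
  let ?m = "sum (bern_weight p J)"
  let ?\<B> = "\<A>1 \<union> \<A>0"
  have sub: "\<A>1 \<subseteq> Pow J" "\<A>0 \<subseteq> Pow J" "?\<B> \<subseteq> Pow J" by (auto simp: \<A>1_def \<A>0_def)
  have fin: "finite \<A>1" "finite \<A>0" using sub insert.hyps(1) by (meson finite_Pow_iff finite_subset)+
  have A_eq: "\<A> = insert a ` \<A>1 \<union> \<A>0"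
  proof (intro subset_antisym subsetI)
    fix T assume T: "T \<in> \<A>"
    then have "T \<subseteq> insert a J" using insert.prems(1) by auto
    show "T \<in> insert a ` \<A>1 \<union> \<A>0"
    proof (cases "a \<in> T")
      case True
      then have "insert a (T - {a}) = T" by auto
      then show ?thesis using T \<open>T \<subseteq> insert a J\<close> by (auto simp: \<A>1_def image_iff intro!: exI[of _ "T - {a}"])
    next
      case False
      then show ?thesis using T \<open>T \<subseteq> insert a J\<close> by (auto simp: \<A>0_def)
    qed
  qed (auto simp: \<A>1_def \<A>0_def)
  have ne: "?\<B> \<noteq> {}" using insert.prems(2) A_eq by auto
  have wpos: "0 < bern_weight p J S" for S
    unfolding bern_weight_def using p by (intro prod_pos) auto
  have mB: "0 < ?m ?\<B>" using wpos fin ne by (intro sum_pos) auto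
  have mA0: "?m \<A>0 \<le> ?m ?\<B>" using fin less_imp_le[OF wpos] by (intro sum_mono2) auto
  obtain v where v: "\<And>S. S \<subseteq> J \<Longrightarrow> hull_dominating ?\<B> S (v S)" "?m ?\<B> * exp_mean p J v \<le> 1"
    using insert.IH[OF sub(3) ne] by auto
  have v': "exp_mean p J v \<le> 1 / ?m ?\<B>" using v(2) mB by (simp add: field_simps)
  obtain w where w: "\<And>S. S \<subseteq> J \<Longrightarrow> hull_dominating \<A> (insert a S) (w S)"
    "(\<Sum>S\<in>Pow J. bern_weight p J S * exp ((\<Sum>j\<in>insert a S. (w S j)\<^sup>2) / 4)) \<le> 1 / ?m ?\<B> * (2 - ?m \<A>1 / ?m ?\<B>)"
  proof -
    have "\<exists>T'\<in>\<A>. T' - {a} = T - {a}" if "T \<in> ?\<B>" for T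
    proof -
      from that have "insert a T \<in> \<A> \<or> T \<in> \<A>" by (auto simp: \<A>1_def \<A>0_def)
      moreover have "insert a T - {a} = T - {a}" by simp
      ultimately show ?thesis by metis
    qed
    note lift = this
    have "\<exists>w. (\<forall>S\<subseteq>J. hull_dominating \<A> (insert a S) (w S)) \<and>
      (\<Sum>S\<in>Pow J. bern_weight p J S * exp ((\<Sum>j\<in>insert a S. (w S j)\<^sup>2) / 4)) \<le> 1 / ?m ?\<B> * (2 - ?m \<A>1 / ?m ?\<B>)"
    proof (rule talagrand_upper_section[OF insert.hyps(1,2) p Un_upper1 sub(3) ne _ lift])
      show "insert a T \<in> \<A>" if "T \<in> \<A>1" for T using that by (simp add: \<A>1_def)
    qed (use insert.IH in blast)+
    then show ?thesis using that by blast
  qed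
  let ?z = "\<lambda>S. if a \<in> S then w (S - {a}) else v S"
  have "hull_dominating \<A> S (?z S)" if S: "S \<subseteq> insert a J" for S
  proof (cases "a \<in> S")
    case True
    then have "insert a (S - {a}) = S" "S - {a} \<subseteq> J" using S by auto
    then show ?thesis using w(1)[of "S - {a}"] True by simp
  next
    case False
    then have SJ: "S \<subseteq> J" using S by auto
    show ?thesis unfolding hull_dominating_def
    proof (intro allI impI)
      fix g :: "'a \<Rightarrow> real" assume "\<forall>j. 0 \<le> g j"
      then obtain T where T: "T \<in> ?\<B>" "sum g (S - T) \<le> (\<Sum>j\<in>S. g j * v S j)"
        using v(1)[OF SJ] unfolding hull_dominating_def by blast
      then have "T \<in> \<A> \<or> insert a T \<in> \<A>" by (auto simp: \<A>1_def \<A>0_def)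
      then obtain T' where T': "T' \<in> \<A>" "T' = T \<or> T' = insert a T" by blast
      then have "S - T' = S - T" using False by auto
      then have "sum g (S - T') \<le> (\<Sum>j\<in>S. g j * ?z S j)" using T(2) False by simp
      then show "\<exists>T\<in>\<A>. sum g (S - T) \<le> (\<Sum>j\<in>S. g j * ?z S j)"
        using T'(1) by blast
    qed
  qed
  moreover have "sum (bern_weight p (insert a J)) \<A> * exp_mean p (insert a J) ?z \<le> 1"
  proof -
    have "a \<notin> T" if "T \<in> ?\<B>" for T using that sub insert.hyps by auto
    then have inj: "inj_on (insert a) \<A>1" and disj: "insert a ` \<A>1 \<inter> \<A>0 = {}"
      by (auto simp: inj_on_def insert_ident)
    have mA: "sum (bern_weight p (insert a J)) \<A> = p a * ?m \<A>1 + (1 - p a) * ?m \<A>0"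
    proof -
      have "sum (bern_weight p (insert a J)) \<A> = (\<Sum>T\<in>\<A>1. bern_weight p (insert a J) (insert a T))
          + (\<Sum>T\<in>\<A>0. bern_weight p (insert a J) T)"
        unfolding A_eq using fin disj inj by (simp add: sum.union_disjoint sum.reindex)
      also have "\<dots> = (\<Sum>T\<in>\<A>1. p a * bern_weight p J T) + (\<Sum>T\<in>\<A>0. (1 - p a) * bern_weight p J T)"
        using sub insert.hyps by (intro arg_cong2[where f="(+)"] sum.cong) (auto simp: bern_weight_insert)
      finally show ?thesis by (simp add: sum_distrib_left)
    qed
    let ?W = "(\<Sum>S\<in>Pow J. bern_weight p J S * exp ((\<Sum>j\<in>insert a S. (w S j)\<^sup>2) / 4))"
    have "exp_mean p (insert a J) ?z = (1 - p a) * exp_mean p J v + p a * ?W"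
      unfolding exp_mean_def sum_Pow_insert[OF insert.hyps(1,2)] sum_distrib_left sum.distrib[symmetric]
    proof (intro sum.cong refl)
      fix S assume "S \<in> Pow J"
      then have S: "S \<subseteq> J" "a \<notin> S" "insert a S - {a} = S" using insert.hyps by auto
      then show "bern_weight p (insert a J) S * exp ((\<Sum>j\<in>S. (?z S j)\<^sup>2) / 4) +
        bern_weight p (insert a J) (insert a S) * exp ((\<Sum>j\<in>insert a S. (?z (insert a S) j)\<^sup>2) / 4) =
        (1 - p a) * (bern_weight p J S * exp ((\<Sum>j\<in>S. (v S j)\<^sup>2) / 4)) +
        p a * (bern_weight p J S * exp ((\<Sum>j\<in>insert a S. (w S j)\<^sup>2) / 4))"
        using insert.hyps by (simp add: bern_weight_insert)
    qed
    \<comment> \<open>The bound \<open>1 / ?m ?\<B>\<close> for \<open>v\<close> is weakened by the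
      factor \<open>2 - ?m \<A>0 / ?m ?\<B>\<close>, which is at least 1, to give both cases the
      same affine form. Averaging over the coordinate \<open>a\<close> then reassembles the mass of
      \<open>\<A>\<close>.\<close>
    also have "\<dots> \<le> (1 - p a) * (1 / ?m ?\<B> * (2 - ?m \<A>0 / ?m ?\<B>)) + p a * (1 / ?m ?\<B> * (2 - ?m \<A>1 / ?m ?\<B>))"
    proof (intro add_mono mult_left_mono w(2))
      have "1 / ?m ?\<B> * 1 \<le> 1 / ?m ?\<B> * (2 - ?m \<A>0 / ?m ?\<B>)"
        using mB mA0 by (intro mult_left_mono) auto
      then show "exp_mean p J v \<le> 1 / ?m ?\<B> * (2 - ?m \<A>0 / ?m ?\<B>)" using v' by linarith
      show "0 \<le> 1 - p a" "0 \<le> p a" using p[of a] by auto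
    qed
    also have "\<dots> = 1 / ?m ?\<B> * (2 - sum (bern_weight p (insert a J)) \<A> / ?m ?\<B>)"
      unfolding mA by (rule talagrand_average)
    finally have "sum (bern_weight p (insert a J)) \<A> * exp_mean p (insert a J) ?z
       \<le> sum (bern_weight p (insert a J)) \<A> * (1 / ?m ?\<B> * (2 - sum (bern_weight p (insert a J)) \<A> / ?m ?\<B>))"
      using p by (intro mult_left_mono sum_nonneg bern_weight_nonneg) (auto simp: less_imp_le)
    also have "\<dots> \<le> 1" using talagrand_combine[OF mB] .
    finally show ?thesis .
  qed
  ultimately show ?case by (intro exI[of _ ?z] conjI allI impI)
qed

text \<open>By Cauchy-Schwarz, a weight of norm at most 1 that separates \<open>S\<close> from all
  of \<open>\<A>\<close> by \<open>r\<close> forces every hull vector of \<open>S\<close> to have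
  norm at least \<open>r\<close>. Markov's inequality for the exponential mean gives the product
  bound.\<close>

lemma talagrand_bernoulli_separated:
  assumes "finite J" and p: "\<And>j. 0 < p j" "\<And>j. p j < 1"
    and "\<A> \<subseteq> Pow J" "\<B> \<subseteq> Pow J" and "0 \<le> r"
    and sep: "\<And>S. S \<in> \<B> \<Longrightarrow> \<exists>g. (\<forall>j. 0 \<le> g j) \<and> (\<Sum>j\<in>S. (g j)\<^sup>2) \<le> 1 \<and> (\<forall>T\<in>\<A>. r \<le> sum g (S - T))"
  shows "sum (bern_weight p J) \<A> * sum (bern_weight p J) \<B> \<le> exp (- (r\<^sup>2 / 4))"
proof (cases "\<A> = {}")
  case False
  have nn: "0 \<le> bern_weight p J S" for S using p by (intro bern_weight_nonneg) (auto simp: less_imp_le)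
  obtain v where v: "\<And>S. S \<subseteq> J \<Longrightarrow> hull_dominating \<A> S (v S)"
      "sum (bern_weight p J) \<A> * exp_mean p J v \<le> 1"
    using talagrand_bernoulli[of J p, OF assms(1) p assms(4) False] by blast
  have "r\<^sup>2 \<le> (\<Sum>j\<in>S. (v S j)\<^sup>2)" if S: "S \<in> \<B>" for S
  proof -
    obtain g where g: "\<forall>j. 0 \<le> g j" "(\<Sum>j\<in>S. (g j)\<^sup>2) \<le> 1" "\<forall>T\<in>\<A>. r \<le> sum g (S - T)"
      using sep[OF S] by blast
    obtain T where T: "T \<in> \<A>" "sum g (S - T) \<le> (\<Sum>j\<in>S. g j * v S j)"
      using v(1)[of S] g(1) S assms(5) unfolding hull_dominating_def by blast
    then have "r \<le> (\<Sum>j\<in>S. g j * v S j)" using g(3) by force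
    then have "r\<^sup>2 \<le> (\<Sum>j\<in>S. g j * v S j)\<^sup>2" using \<open>0 \<le> r\<close> by (intro power_mono)
    also have "\<dots> \<le> (\<Sum>j\<in>S. (g j)\<^sup>2) * (\<Sum>j\<in>S. (v S j)\<^sup>2)" by (rule Cauchy_Schwarz_ineq_sum)
    also have "\<dots> \<le> 1 * (\<Sum>j\<in>S. (v S j)\<^sup>2)" using g(2) by (intro mult_right_mono) (auto intro: sum_nonneg)
    finally show ?thesis by simp
  qed
  then have "sum (bern_weight p J) \<B> * exp (r\<^sup>2 / 4)
     \<le> (\<Sum>S\<in>\<B>. bern_weight p J S * exp ((\<Sum>j\<in>S. (v S j)\<^sup>2) / 4))"
    unfolding sum_distrib_right by (intro sum_mono mult_left_mono nn) auto
  also have "\<dots> \<le> exp_mean p J v"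
    unfolding exp_mean_def using assms(1,5) nn by (intro sum_mono2) auto
  finally have "sum (bern_weight p J) \<A> * (sum (bern_weight p J) \<B> * exp (r\<^sup>2 / 4))
     \<le> sum (bern_weight p J) \<A> * exp_mean p J v"
    using nn by (intro mult_left_mono) (auto intro: sum_nonneg)
  with v(2) have "sum (bern_weight p J) \<A> * sum (bern_weight p J) \<B> * exp (r\<^sup>2 / 4) \<le> 1"
    by (simp add: mult.assoc)
  then show ?thesis by (simp add: exp_minus field_simps)
qed simp

section \<open>From Bernoulli variables to binomial and Poisson counts\<close>

lemma sum_bern_weight_card:
  assumes "finite K"
  shows "(\<Sum>R | R \<subseteq> K \<and> card R = x. \<Prod>k\<in>K. if k \<in> R then p else 1 - p)
    = real (card K choose x) * p ^ x * (1 - p) ^ (card K - x)"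
proof -
  have "(\<Prod>k\<in>K. if k \<in> R then p else 1 - p) = p ^ x * (1 - p) ^ (card K - x)" if "R \<subseteq> K" "card R = x" for R
  proof -
    have "(\<Prod>k\<in>K. if k \<in> R then p else 1 - p) = p ^ card (K \<inter> R) * (1 - p) ^ card (K - R)"
      using assms by (simp add: prod.If_cases Diff_eq Int_commute)
    also have "K \<inter> R = R" using that by auto
    also have "card (K - R) = card K - x" using that assms finite_subset by (subst card_Diff_subset) auto
    finally show ?thesis using that by simp
  qed
  then have "(\<Sum>R | R \<subseteq> K \<and> card R = x. \<Prod>k\<in>K. if k \<in> R then p else 1 - p)
     = (\<Sum>R | R \<subseteq> K \<and> card R = x. p ^ x * (1 - p) ^ (card K - x))"
    by (intro sum.cong) auto
  then show ?thesis using n_subsets[OF assms] by simp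
qed

text \<open>Each index \<open>i\<close> owns a row of 0/1 variables. Restriction to \<open>I\<close>
  turns a vector of counts into a unique extensional function, so that vectors can be compared by
  equality.\<close>

definition row_counts :: "'i set \<Rightarrow> ('i \<times> nat) set \<Rightarrow> 'i \<Rightarrow> nat" where
  "row_counts I S = restrict (\<lambda>i. card {k. (i, k) \<in> S}) I"

text \<open>Expanding the product of binomial sums gives one term for each choice of a subset in
  every row, and \<open>Sigma\<close> identifies these choices with subsets of the grid.\<close>

lemma sum_bern_weight_row_counts:
  assumes "finite I" "x \<in> extensional I"
  shows "sum (bern_weight (\<lambda>(i, k). p i) (I \<times> {..<n})) {S \<in> Pow (I \<times> {..<n}). row_counts I S = x}
    = (\<Prod>i\<in>I. real (n choose x i) * p i ^ x i * (1 - p i) ^ (n - x i))"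
proof -
  let ?B = "\<lambda>i. {R. R \<subseteq> {..<n} \<and> card R = x i}"
  let ?X = "{S \<in> Pow (I \<times> {..<n}). row_counts I S = x}"
  have "(\<Prod>i\<in>I. real (n choose x i) * p i ^ x i * (1 - p i) ^ (n - x i))
     = (\<Prod>i\<in>I. \<Sum>R\<in>?B i. \<Prod>k<n. if k \<in> R then p i else 1 - p i)"
    using sum_bern_weight_card[of "{..<n}"] by simp
  also have "\<dots> = (\<Sum>R\<in>PiE I ?B. \<Prod>i\<in>I. \<Prod>k<n. if k \<in> R i then p i else 1 - p i)"
    using assms(1) by (intro prod_sum_PiE) auto
  also have "\<dots> = (\<Sum>S\<in>?X. bern_weight (\<lambda>(i, k). p i) (I \<times> {..<n}) S)"
  proof (rule sum.reindex_bij_witness[where i = "\<lambda>S. restrict (\<lambda>i. {k. (i, k) \<in> S}) I" and j = "\<lambda>R. Sigma I R"])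
    fix R assume R: "R \<in> PiE I ?B"
    show "restrict (\<lambda>i. {k. (i, k) \<in> Sigma I R}) I = R"
      using R by (auto simp: restrict_def PiE_def extensional_def fun_eq_iff)
    have "row_counts I (Sigma I R) = x"
      using R assms(2) by (auto simp: row_counts_def restrict_def PiE_def extensional_def fun_eq_iff)
    then show "Sigma I R \<in> ?X" using R by (auto simp: PiE_def Pi_def)
    show "bern_weight (\<lambda>(i, k). p i) (I \<times> {..<n}) (Sigma I R) = (\<Prod>i\<in>I. \<Prod>k<n. if k \<in> R i then p i else 1 - p i)"
      unfolding bern_weight_def prod.cartesian_product by (intro prod.cong) (auto split: if_splits)
  next
    fix S assume S: "S \<in> ?X"
    then show "Sigma I (restrict (\<lambda>i. {k. (i, k) \<in> S}) I) = S"
      by (intro set_eqI) (auto simp: subset_iff mem_Times_iff)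
    show "restrict (\<lambda>i. {k. (i, k) \<in> S}) I \<in> PiE I ?B"
      using S by (auto simp: row_counts_def PiE_def)
  qed
  finally show ?thesis by simp
qed

lemma binomial_over_power_tendsto: "(\<lambda>n. real (n choose k) / real n ^ k) \<longlonglongrightarrow> 1 / fact k"
proof (induction k)
  case (Suc k)
  have "(\<lambda>n. real (n choose k) / real n ^ k * ((real n - real k) / (real n * real (Suc k))))
      \<longlonglongrightarrow> 1 / fact k * (1 / real (Suc k))"
  proof (intro tendsto_mult Suc.IH)
    show "(\<lambda>n. (real n - real k) / (real n * real (Suc k))) \<longlonglongrightarrow> 1 / real (Suc k)"
      by (real_asymp simp: inverse_eq_divide)
  qed
  moreover have "\<forall>\<^sub>F n in sequentially. real (n choose k) / real n ^ k * ((real n - real k) / (real n * real (Suc k)))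
      = real (n choose Suc k) / real n ^ Suc k"
    using eventually_ge_at_top[of "Suc k"]
  proof eventually_elim
    case (elim n)
    have "Suc k * (n choose Suc k) = (n - k) * (n choose k)"
      by (simp only: binomial_absorption binomial_absorb_comp)
    then have "real (Suc k) * real (n choose Suc k) = (real n - real k) * real (n choose k)"
      using elim by (metis Suc_leD of_nat_diff of_nat_mult)
    then have "real (n choose Suc k) = (real n - real k) * real (n choose k) / real (Suc k)"
      by (simp add: field_simps)
    then show ?case using elim by (simp add: ac_simps)
  qed
  ultimately have "(\<lambda>n. real (n choose Suc k) / real n ^ Suc k) \<longlonglongrightarrow> 1 / fact k * (1 / real (Suc k))"
    by (rule Lim_transform_eventually)
  then show ?case by (simp add: mult.commute)
qed simp

lemma binomial_tendsto_poisson: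
  "(\<lambda>n. real (n choose k) * (m / real n) ^ k * (1 - m / real n) ^ (n - k)) \<longlonglongrightarrow> m ^ k / fact k * exp (- m)"
proof -
  have lim: "(\<lambda>n. real (n choose k) / real n ^ k * m ^ k * ((1 + (- m) / real n) ^ n / (1 - m / real n) ^ k))
    \<longlonglongrightarrow> 1 / fact k * m ^ k * (exp (- m) / (1 - 0) ^ k)"
    by (intro tendsto_mult tendsto_divide tendsto_power tendsto_diff binomial_over_power_tendsto
        tendsto_exp_limit_sequentially tendsto_const tendsto_divide_0[OF tendsto_const]
        filterlim_at_top_imp_at_infinity filterlim_real_sequentially) auto
  have ev: "\<forall>\<^sub>F n in sequentially. real (n choose k) / real n ^ k * m ^ k * ((1 + (- m) / real n) ^ n / (1 - m / real n) ^ k)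
    = real (n choose k) * (m / real n) ^ k * (1 - m / real n) ^ (n - k)"
  proof -
    obtain N where N: "m < real N" using reals_Archimedean2 by blast
    show ?thesis using eventually_ge_at_top[of "Suc (max k N)"]
    proof eventually_elim
      case (elim n)
      then have "m < real n" using N by simp
      then have "1 - m / real n \<noteq> 0" using elim by (simp add: field_simps)
      then show ?case using elim by (simp add: power_diff power_divide)
    qed
  qed
  from Lim_transform_eventually[OF lim ev] show ?thesis by simp
qed

definition poisson_weight :: "'i set \<Rightarrow> ('i \<Rightarrow> real) \<Rightarrow> ('i \<Rightarrow> nat) \<Rightarrow> real" where
  "poisson_weight I m x = (\<Prod>i\<in>I. m i ^ x i / fact (x i) * exp (- m i))"

text \<open>A finite-dimensional counterpart of \<open>convex_dist\<close> exceeding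
  \<open>r\<close>, for count vectors. Subtraction of naturals is truncated and thus is the positive
  part.\<close>

definition count_separated :: "'i set \<Rightarrow> real \<Rightarrow> ('i \<Rightarrow> nat) set \<Rightarrow> ('i \<Rightarrow> nat) \<Rightarrow> bool" where
  "count_separated I r \<A> x \<longleftrightarrow> (\<exists>g. (\<forall>i. 0 \<le> g i) \<and> (\<Sum>i\<in>I. real (x i) * (g i)\<^sup>2) \<le> 1 \<and>
     (\<forall>y\<in>\<A>. r < (\<Sum>i\<in>I. g i * real (x i - y i))))"

text \<open>The weight is copied along each row. Its squared norm over \<open>S\<close> becomes the
  sum of count times weight squared, and row \<open>i\<close> of \<open>S - T\<close> has at least
  as many elements as the truncated difference of the two counts.\<close>

lemma row_counts_separated:
  assumes "finite I" "S \<subseteq> I \<times> {..<n}" "count_separated I r \<F> (row_counts I S)"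
  shows "\<exists>g. (\<forall>j. 0 \<le> g j) \<and> (\<Sum>j\<in>S. (g j)\<^sup>2) \<le> 1 \<and>
    (\<forall>T\<in>{T \<in> Pow (I \<times> {..<n}). row_counts I T \<in> \<F>}. r \<le> sum g (S - T))"
proof -
  obtain g where g: "\<forall>i. 0 \<le> g i" "(\<Sum>i\<in>I. real (row_counts I S i) * (g i)\<^sup>2) \<le> 1"
    "\<forall>y\<in>\<F>. r < (\<Sum>i\<in>I. g i * real (row_counts I S i - y i))"
    using assms(3) unfolding count_separated_def by blast
  have fin: "finite {k. (i, k) \<in> T}" if "T \<subseteq> I \<times> {..<n}" for i T
    using that by (auto intro: finite_subset[of _ "{..<n}"])
  have Sigma_eq: "T = Sigma I (\<lambda>i. {k. (i, k) \<in> T})" if "T \<subseteq> I \<times> {..<n}" for T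
    using that by (intro set_eqI) (auto simp: subset_iff mem_Times_iff)
  have sum_eq: "(\<Sum>j\<in>T. h (fst j)) = (\<Sum>i\<in>I. real (card {k. (i, k) \<in> T}) * h i)"
    if "T \<subseteq> I \<times> {..<n}" for T and h :: "'a \<Rightarrow> real"
  proof -
    have "(\<Sum>j\<in>T. h (fst j)) = (\<Sum>j\<in>Sigma I (\<lambda>i. {k. (i, k) \<in> T}). h (fst j))"
      using Sigma_eq[OF that] by simp
    also have "\<dots> = (\<Sum>i\<in>I. \<Sum>k\<in>{k. (i, k) \<in> T}. h i)"
      using fin[OF that] assms(1) by (subst sum.Sigma) (auto simp: case_prod_beta)
    finally show ?thesis by simp
  qed
  have "(\<Sum>j\<in>S. (g (fst j))\<^sup>2) \<le> 1"
    using g(2) sum_eq[OF assms(2), of "\<lambda>i. (g i)\<^sup>2"] by (simp add: row_counts_def)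
  moreover have "r \<le> (\<Sum>j\<in>S - T. g (fst j))" if T: "T \<subseteq> I \<times> {..<n}" "row_counts I T \<in> \<F>" for T
  proof -
    have "r \<le> (\<Sum>i\<in>I. g i * real (row_counts I S i - row_counts I T i))" using g(3) T(2) by force
    also have "\<dots> \<le> (\<Sum>i\<in>I. g i * real (card {k. (i, k) \<in> S - T}))"
    proof (intro sum_mono mult_left_mono)
      fix i assume "i \<in> I"
      have "{k. (i, k) \<in> S - T} = {k. (i, k) \<in> S} - {k. (i, k) \<in> T}" by auto
      then show "real (row_counts I S i - row_counts I T i) \<le> real (card {k. (i, k) \<in> S - T})"
        using \<open>i \<in> I\<close> diff_card_le_card_Diff[OF fin[OF T(1)]] by (simp add: row_counts_def)
    qed (use g(1) in auto)
    also have "\<dots> = (\<Sum>j\<in>S - T. g (fst j))"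
    proof -
      have "S - T \<subseteq> I \<times> {..<n}" using assms(2) by blast
      from sum_eq[OF this, of g] show ?thesis by (simp add: mult.commute)
    qed
    finally show ?thesis .
  qed
  ultimately show ?thesis using g(1) by (intro exI[of _ "\<lambda>j. g (fst j)"]) auto
qed

text \<open>Each count is approximated by a sum of \<open>n\<close> Bernoulli variables of mean
  \<open>m i / n\<close>, and the bound is free of \<open>n\<close>. Finiteness of
  \<open>\<F>\<close> and \<open>\<G>\<close> lets the limit pass through the sums.\<close>

lemma talagrand_poisson_pos:
  assumes "finite I" "\<And>i. 0 < m i" "0 \<le> r"
    and "finite \<F>" "finite \<G>" "\<F> \<subseteq> extensional I" "\<G> \<subseteq> extensional I"
    and sep: "\<And>x. x \<in> \<G> \<Longrightarrow> count_separated I r \<F> x"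
  shows "sum (poisson_weight I m) \<F> * sum (poisson_weight I m) \<G> \<le> exp (- (r\<^sup>2 / 4))"
proof -
  define b where "b n x = (\<Prod>i\<in>I. real (n choose x i) * (m i / real n) ^ x i * (1 - m i / real n) ^ (n - x i))"
    for n x
  have "(\<lambda>n. sum (b n) \<F> * sum (b n) \<G>) \<longlonglongrightarrow> sum (poisson_weight I m) \<F> * sum (poisson_weight I m) \<G>"
    unfolding b_def poisson_weight_def by (intro tendsto_intros binomial_tendsto_poisson)
  moreover have "\<forall>\<^sub>F n in sequentially. sum (b n) \<F> * sum (b n) \<G> \<le> exp (- (r\<^sup>2 / 4))"
  proof -
    obtain N where N: "sum m I < real N" using reals_Archimedean2 by blast
    show ?thesis using eventually_ge_at_top[of "Suc N"]
    proof eventually_elim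
      case (elim n)
      \<comment> \<open>Outside \<open>I\<close> any value strictly between 0 and 1 serves; on
        \<open>I\<close> the choice of \<open>N\<close> keeps the parameter below 1.\<close>
      define p where "p i = (if i \<in> I then m i / real n else 1 / 2)" for i
      have mle: "m i \<le> sum m I" if "i \<in> I" for i
        using that assms(1,2) by (intro member_le_sum) (auto simp: less_imp_le)
      have "0 < p i" "p i < 1" for i
        using elim assms(2)[of i] mle[of i] N by (auto simp: p_def field_simps)
      then have p: "0 < (\<lambda>(i, k :: nat). p i) j" "(\<lambda>(i, k :: nat). p i) j < 1" for j by (auto split: prod.split)
      let ?L = "\<lambda>\<F>. {S \<in> Pow (I \<times> {..<n}). row_counts I S \<in> \<F>}"
      have b: "sum (b n) \<H> = sum (bern_weight (\<lambda>(i, k). p i) (I \<times> {..<n})) (?L \<H>)"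
        if \<H>: "finite \<H>" "\<H> \<subseteq> extensional I" for \<H>
      proof -
        have "sum (bern_weight (\<lambda>(i, k). p i) (I \<times> {..<n})) (?L \<H>)
          = (\<Sum>x\<in>\<H>. sum (bern_weight (\<lambda>(i, k). p i) (I \<times> {..<n})) {S \<in> ?L \<H>. row_counts I S = x})"
          using assms(1) \<H> by (intro sum.group[symmetric]) auto
        also have "\<dots> = sum (b n) \<H>"
        proof (intro sum.cong refl)
          fix x assume x: "x \<in> \<H>"
          then have "{S \<in> ?L \<H>. row_counts I S = x} = {S \<in> Pow (I \<times> {..<n}). row_counts I S = x}" by auto
          moreover have "(\<Prod>i\<in>I. real (n choose x i) * p i ^ x i * (1 - p i) ^ (n - x i)) = b n x"
            unfolding b_def p_def by (intro prod.cong) auto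
          ultimately show "sum (bern_weight (\<lambda>(i, k). p i) (I \<times> {..<n})) {S \<in> ?L \<H>. row_counts I S = x} = b n x"
            using sum_bern_weight_row_counts[OF assms(1), of x p n] \<H>(2) x by auto
        qed
        finally show ?thesis by simp
      qed
      show ?case unfolding b[OF assms(4,6)] b[OF assms(5,7)]
      proof (rule talagrand_bernoulli_separated)
        fix S assume "S \<in> ?L \<G>"
        then show "\<exists>g. (\<forall>j. 0 \<le> g j) \<and> (\<Sum>j\<in>S. (g j)\<^sup>2) \<le> 1 \<and> (\<forall>T\<in>?L \<F>. r \<le> sum g (S - T))"
          using row_counts_separated[OF assms(1), of S n r \<F>] sep by auto
      qed (use assms p in auto)
    qed
  qed
  ultimately show ?thesis by (rule LIMSEQ_le_const2[OF _ eventually_sequentially[THEN iffD1]])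
qed

text \<open>Cells of intensity 0 have mean 0. The weights are continuous in the means, so these are
  first raised by \<open>1 / real (Suc n)\<close>.\<close>

lemma talagrand_poisson:
  assumes "finite I" "\<And>i. 0 \<le> m i" "0 \<le> r"
    and "finite \<F>" "finite \<G>" "\<F> \<subseteq> extensional I" "\<G> \<subseteq> extensional I"
    and sep: "\<And>x. x \<in> \<G> \<Longrightarrow> count_separated I r \<F> x"
  shows "sum (poisson_weight I m) \<F> * sum (poisson_weight I m) \<G> \<le> exp (- (r\<^sup>2 / 4))"
proof -
  define m' where "m' n i = m i + 1 / real (Suc n)" for n i
  have m': "(\<lambda>n. m' n i) \<longlonglongrightarrow> m i" for i
    unfolding m'_def using tendsto_add[OF tendsto_const LIMSEQ_Suc[OF lim_1_over_n], of "m i"] by simp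
  have "(\<lambda>n. sum (poisson_weight I (m' n)) \<F> * sum (poisson_weight I (m' n)) \<G>)
    \<longlonglongrightarrow> sum (poisson_weight I m) \<F> * sum (poisson_weight I m) \<G>"
    unfolding poisson_weight_def by (intro tendsto_intros m') auto
  moreover have "sum (poisson_weight I (m' n)) \<F> * sum (poisson_weight I (m' n)) \<G> \<le> exp (- (r\<^sup>2 / 4))" for n
    using assms by (intro talagrand_poisson_pos) (auto simp: m'_def intro: add_nonneg_pos)
  ultimately show ?thesis by (intro LIMSEQ_le_const2) auto
qed

section \<open>Configurations and vague Borel sets\<close>

lemma configuration_sets: "\<xi> \<in> configurations \<Longrightarrow> sets \<xi> = sets borel"
  by (simp add: configurations_def)

text \<open>The list of Dirac masses becomes an indexed family of points, repeated by multiplicity: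
  masses turn into cardinalities of index sets, and points can be followed along sequences.\<close>

lemma configuration_points:
  fixes \<xi> :: "'a::metric_space measure"
  assumes "\<xi> \<in> configurations" "R \<in> sets borel" "bounded R"
  shows "\<exists>(c::nat) p. (\<forall>i<c. p i \<in> R) \<and>
    (\<forall>B\<in>sets borel. emeasure \<xi> (B \<inter> R) = of_nat (card {i. i < c \<and> p i \<in> B}))"
proof -
  obtain z e where e: "R \<subseteq> cball z e"
    using assms(3) unfolding bounded_def subset_iff mem_cball by blast
  obtain xs where xs: "\<And>B. B \<in> sets borel \<Longrightarrow>
      emeasure \<xi> (B \<inter> cball z e) = (\<Sum>x\<leftarrow>xs. emeasure (return borel x) B)"
    using assms(1) unfolding configurations_def by blast
  define ys where "ys = filter (\<lambda>x. x \<in> R) xs"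
  have "emeasure \<xi> (B \<inter> R) = of_nat (card {i. i < length ys \<and> ys ! i \<in> B})" if B: "B \<in> sets borel" for B
  proof -
    have BR: "B \<inter> R \<in> sets borel" using B assms(2) by auto
    have "B \<inter> R = (B \<inter> R) \<inter> cball z e" using e by auto
    then have "emeasure \<xi> (B \<inter> R) = emeasure \<xi> ((B \<inter> R) \<inter> cball z e)" by simp
    also have "\<dots> = (\<Sum>x\<leftarrow>xs. emeasure (return borel x) (B \<inter> R))" using xs[OF BR] .
    also have "\<dots> = (\<Sum>x\<leftarrow>xs. indicator (B \<inter> R) x)" using BR by simp
    also have "\<dots> = of_nat (length (filter (\<lambda>x. x \<in> B) ys))"
      unfolding ys_def by (induction xs) auto
    finally show ?thesis by (simp add: length_filter_conv_card)
  qed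
  moreover have "ys ! i \<in> R" if "i < length ys" for i
    using nth_mem[OF that] by (auto simp: ys_def)
  ultimately show ?thesis by (intro exI[of _ "length ys"] exI[of _ "(!) ys"]) auto
qed

text \<open>Meaningful only for sets of finite mass; \<open>measure \<xi> B\<close> and hence \<open>npoints \<xi> B\<close> is 0 otherwise.\<close>

definition npoints :: "'a measure \<Rightarrow> 'a set \<Rightarrow> nat" where
  "npoints \<xi> B = nat \<lfloor>measure \<xi> B\<rfloor>"

lemma npoints_eqI: "emeasure \<xi> B = of_nat c \<Longrightarrow> npoints \<xi> B = c"
  by (simp add: npoints_def measure_def)

lemma emeasure_npoints:
  assumes "\<xi> \<in> configurations" "B \<in> sets borel" "bounded B"
  shows "emeasure \<xi> B = of_nat (npoints \<xi> B)"
proof -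
  obtain c p where "\<forall>i<c. p i \<in> B"
    and p: "\<forall>B'\<in>sets borel. emeasure \<xi> (B' \<inter> B) = of_nat (card {i::nat. i < c \<and> p i \<in> B'})"
    using configuration_points[OF assms] by blast
  from bspec[OF p, of UNIV] have "emeasure \<xi> B = of_nat c" by simp
  then show ?thesis by (simp add: npoints_eqI)
qed

lemma measure_npoints:
  assumes "\<xi> \<in> configurations" "B \<in> sets borel" "bounded B"
  shows "measure \<xi> B = real (npoints \<xi> B)"
  by (simp add: measure_def emeasure_npoints[OF assms])

lemma npoints_mono:
  assumes "\<xi> \<in> configurations" "A \<in> sets borel" "B \<in> sets borel" "bounded B" "A \<subseteq> B"
  shows "npoints \<xi> A \<le> npoints \<xi> B"
  using emeasure_mono[of A B \<xi>] emeasure_npoints[OF assms(1)] assms bounded_subset[OF assms(4,5)]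
  by (simp add: configuration_sets)

text \<open>The converse construction, from a locally finite family of points; it produces the limit
  configuration in \<open>profile_limit\<close>.\<close>

lemma point_configuration:
  fixes q :: "'i \<Rightarrow> 'a::metric_space"
  assumes "\<And>z R. finite {j \<in> J. q j \<in> cball z R}"
  defines "\<xi> \<equiv> distr (count_space J) borel q"
  shows "\<xi> \<in> configurations"
    and "B \<in> sets borel \<Longrightarrow> bounded B \<Longrightarrow> emeasure \<xi> B = of_nat (card {j \<in> J. q j \<in> B})"
proof -
  have em: "emeasure \<xi> B = emeasure (count_space J) {j \<in> J. q j \<in> B}" if "B \<in> sets borel" for B
    using that unfolding \<xi>_def by (subst emeasure_distr) (auto intro!: arg_cong2[where f=emeasure])
  have "\<exists>xs. \<forall>B\<in>sets borel. emeasure \<xi> (B \<inter> cball z R) = (\<Sum>x\<leftarrow>xs. emeasure (return borel x) B)" for z R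
  proof -
    obtain js where js: "set js = {j \<in> J. q j \<in> cball z R}" "distinct js"
      using finite_distinct_list[OF assms(1)] by blast
    have "emeasure \<xi> (B \<inter> cball z R) = (\<Sum>x\<leftarrow>map q js. emeasure (return borel x) B)" if B: "B \<in> sets borel" for B
    proof -
      have eq: "{j \<in> J. q j \<in> B \<inter> cball z R} = {j \<in> set js. q j \<in> B}" using js(1) by auto
      have "emeasure \<xi> (B \<inter> cball z R) = emeasure (count_space J) {j \<in> set js. q j \<in> B}"
        unfolding eq[symmetric] using B by (intro em) auto
      also have "\<dots> = of_nat (card {j \<in> set js. q j \<in> B})"
        using js(1) by (subst emeasure_count_space_finite) (auto intro: finite_subset[OF _ List.finite_set[of js]])
      also have "card {j \<in> set js. q j \<in> B} = length (filter (\<lambda>j. q j \<in> B) js)"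
        using distinct_card[of "filter (\<lambda>j. q j \<in> B) js"] js(2) by simp
      also have "of_nat \<dots> = (\<Sum>j\<leftarrow>js. indicator B (q j) :: ennreal)" by (induction js) auto
      also have "\<dots> = (\<Sum>x\<leftarrow>map q js. emeasure (return borel x) B)" using B by (simp add: o_def)
      finally show ?thesis .
    qed
    then show ?thesis by blast
  qed
  then show "\<xi> \<in> configurations" by (simp add: configurations_def \<xi>_def)
  show "emeasure \<xi> B = of_nat (card {j \<in> J. q j \<in> B})" if B: "B \<in> sets borel" "bounded B"
  proof -
    obtain z e where "B \<subseteq> cball z e"
      using B(2) unfolding bounded_def subset_iff mem_cball by blast
    then have "finite {j \<in> J. q j \<in> B}"
      by (intro finite_subset[OF _ assms(1)[of z e]]) (auto simp del: mem_cball)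
    then show ?thesis using em[OF B(1)] by (simp add: emeasure_count_space_finite)
  qed
qed

text \<open>Restricted to \<open>R\<close>, \<open>\<xi>\<close> is the image under \<open>p\<close>
  of the counting measure on the indices, and \<open>f\<close> does not see the rest.\<close>

lemma integral_configuration:
  fixes f :: "'a::metric_space \<Rightarrow> real"
  assumes \<xi>: "\<xi> \<in> configurations" and R: "R \<in> sets borel"
    and f: "f \<in> borel_measurable borel" "\<And>x. x \<notin> R \<Longrightarrow> f x = 0"
    and p: "\<And>B. B \<in> sets borel \<Longrightarrow> emeasure \<xi> (B \<inter> R) = of_nat (card {i::nat. i < c \<and> p i \<in> B})"
  shows "(\<integral>x. f x \<partial>\<xi>) = (\<Sum>i<c. f (p i))"
proof -
  have [measurable_cong]: "sets \<xi> = sets borel" using configuration_sets[OF \<xi>] .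
  note [measurable] = R f(1)
  have "density \<xi> (indicator R) = distr (count_space {..<c}) borel p"
  proof (rule measure_eqI)
    fix B assume "B \<in> sets (density \<xi> (indicator R))"
    then have B: "B \<in> sets borel" by (simp add: configuration_sets[OF \<xi>])
    have "emeasure (density \<xi> (indicator R)) B = emeasure \<xi> (R \<inter> B)"
      using B R configuration_sets[OF \<xi>] by (subst emeasure_density) (auto simp flip: indicator_inter_arith)
    also have "\<dots> = of_nat (card {i. i < c \<and> p i \<in> B})" using p[OF B] by (simp add: Int_commute)
    also have "\<dots> = emeasure (count_space {..<c}) (p -` B \<inter> space (count_space {..<c}))"
      by (subst emeasure_count_space_finite) (auto intro!: arg_cong[where f=card])
    also have "\<dots> = emeasure (distr (count_space {..<c}) borel p) B"
      using B by (intro emeasure_distr[symmetric]) auto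
    finally show "emeasure (density \<xi> (indicator R)) B = emeasure (distr (count_space {..<c}) borel p) B" .
  qed (simp add: configuration_sets[OF \<xi>])
  then have eq: "density \<xi> (\<lambda>x. ennreal (indicator R x)) = distr (count_space {..<c}) borel p"
    by (simp add: ennreal_indicator)
  have "(\<integral>x. f x \<partial>\<xi>) = (\<integral>x. indicator R x *\<^sub>R f x \<partial>\<xi>)"
    using f(2) by (intro Bochner_Integration.integral_cong) (auto simp: indicator_def)
  also have "\<dots> = (\<integral>x. f x \<partial>density \<xi> (\<lambda>x. ennreal (indicator R x)))"
    by (intro integral_density[symmetric]) auto
  also have "\<dots> = (\<integral>i. f (p i) \<partial>count_space {..<c})"
    unfolding eq by (intro integral_distr) auto
  also have "\<dots> = (\<Sum>i<c. f (p i))" by (intro lebesgue_integral_count_space_finite) auto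
  finally show ?thesis .
qed

section \<open>Profiles: countably many counts that describe the vague Borel sets\<close>

text \<open>The whole space is in the basis so that the total count of each ball is itself one of
  the recorded counts.\<close>

locale counting_basis =
  fixes V :: "nat \<Rightarrow> 'a::polish_space set" and z0 :: 'a
  assumes basis: "topological_basis (range V)" and UNIV_V: "UNIV \<in> range V"
begin

definition D :: "nat \<Rightarrow> 'a set" where "D n = cball z0 (real n)"

text \<open>Real values place profiles in a countable product of lines, a Polish space, where finite
  Borel measures are inner regular with respect to compact sets.\<close>

definition profile :: "'a measure \<Rightarrow> nat \<times> nat \<Rightarrow> real" where
  "profile \<xi> = (\<lambda>(i, n). measure \<xi> (V i \<inter> D n))"

lemma open_V: "open (V i)" using topological_basis_open[OF basis] by auto

lemma borel_V [measurable]: "V i \<in> sets borel" using open_V by simp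

lemma borel_D [measurable]: "D n \<in> sets borel" by (simp add: D_def)

lemma bounded_D: "bounded (D n)" by (simp add: D_def)

lemma D_mono: "m \<le> n \<Longrightarrow> D m \<subseteq> D n" by (auto simp: D_def)

lemma bounded_imp_subset_D:
  assumes "bounded S"
  obtains n where "S \<subseteq> D n"
proof -
  obtain e where e: "\<And>x. x \<in> S \<Longrightarrow> dist z0 x \<le> e"
    using assms bounded_any_center[of S z0] by blast
  obtain n where "e \<le> real n" using real_arch_simple by blast
  with e have "S \<subseteq> D n" by (force simp: D_def)
  then show ?thesis using that by blast
qed

lemma basis_nhd:
  assumes "open G" "x \<in> G"
  obtains i where "x \<in> V i" "V i \<subseteq> G"
  by (rule topological_basisE[OF basis assms]) (auto intro: that)

text \<open>The basis set at \<open>x\<close> is taken inside the ball of radius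
  \<open>d x / 2\<close>, where \<open>d x\<close> bounds the distance to the other points from
  below, so two of them cannot meet.\<close>

lemma separating_basis_sets:
  assumes "finite X" "\<And>x. x \<in> X \<Longrightarrow> open (G x) \<and> x \<in> G x"
  obtains k where "\<And>x. x \<in> X \<Longrightarrow> x \<in> V (k x) \<and> V (k x) \<subseteq> G x" "disjoint_family_on (\<lambda>x. V (k x)) X"
proof -
  have "\<exists>d>0. \<forall>y\<in>X. y \<noteq> x \<longrightarrow> d \<le> dist x y" for x using finite_set_avoid[OF assms(1)] .
  then obtain d where d: "\<And>x. 0 < d x" "\<And>x y. y \<in> X \<Longrightarrow> y \<noteq> x \<Longrightarrow> d x \<le> dist x y" by metis
  have "\<exists>i. x \<in> V i \<and> V i \<subseteq> G x \<inter> ball x (d x / 2)" if "x \<in> X" for x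
  proof -
    have "open (G x \<inter> ball x (d x / 2))" "x \<in> G x \<inter> ball x (d x / 2)"
      using assms(2)[OF that] d(1)[of x] by auto
    from basis_nhd[OF this] show ?thesis by metis
  qed
  then obtain k where k: "\<And>x. x \<in> X \<Longrightarrow> x \<in> V (k x) \<and> V (k x) \<subseteq> G x \<inter> ball x (d x / 2)" by metis
  have "disjoint_family_on (\<lambda>x. V (k x)) X"
    unfolding disjoint_family_on_def
  proof (intro ballI impI)
    fix x y assume xy: "x \<in> X" "y \<in> X" "x \<noteq> y"
    show "V (k x) \<inter> V (k y) = {}"
    proof (rule ccontr)
      assume "\<not> ?thesis"
      then obtain z where "z \<in> V (k x)" "z \<in> V (k y)" by blast
      then have "dist x z < d x / 2" "dist y z < d y / 2"
        using k[OF xy(1)] k[OF xy(2)] by (auto simp: subset_iff)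
      then have "dist x y < d x / 2 + d y / 2" using dist_triangle2[of x y z] by linarith
      moreover have "d x \<le> dist x y" "d y \<le> dist x y"
        using d(2)[of y x] d(2)[of x y] xy by (auto simp: dist_commute)
      ultimately show False by linarith
    qed
  qed
  then show ?thesis using k that by blast
qed

lemma profile_npoints:
  assumes "\<xi> \<in> configurations"
  shows "profile \<xi> (i, n) = real (npoints \<xi> (V i \<inter> D n))"
  unfolding profile_def using assms bounded_D bounded_subset[OF bounded_D]
  by (auto intro!: measure_npoints)

text \<open>Counts are integers, so a profile within 1 of that of \<open>\<xi>\<close> at finitely
  many coordinates has the same counts there. Fixing the total in \<open>D n\<close> and the counts
  in small disjoint basis sets around the points of \<open>\<xi>\<close> forces all points of
  \<open>\<zeta>\<close> in \<open>D n\<close> into these sets, with the multiplicities of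
  \<open>\<xi>\<close>, and \<open>f\<close> varies little on each set.\<close>

lemma vague_subbasis_profile:
  assumes f: "f \<in> vague_test_functions" and U: "open U"
    and \<xi>: "\<xi> \<in> configurations" "(\<integral>x. f x \<partial>\<xi>) \<in> U"
  shows "\<exists>W. open W \<and> profile \<xi> \<in> W \<and> (\<forall>\<zeta>\<in>configurations. profile \<zeta> \<in> W \<longrightarrow> (\<integral>x. f x \<partial>\<zeta>) \<in> U)"
proof -
  have cont: "continuous_on UNIV f" using f by (simp add: vague_test_functions_def)
  then have [measurable]: "f \<in> borel_measurable borel" by (rule borel_measurable_continuous_onI)
  obtain z R where zR: "\<And>x. x \<notin> cball z R \<Longrightarrow> f x = 0"
    using f unfolding vague_test_functions_def by blast
  obtain n where n: "cball z R \<subseteq> D n" using bounded_imp_subset_D[OF bounded_cball] .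
  have f0: "f x = 0" if "x \<notin> D n" for x using that n zR by blast
  obtain c p where "\<forall>i<c. p i \<in> D n"
    "\<forall>B\<in>sets borel. emeasure \<xi> (B \<inter> D n) = of_nat (card {i::nat. i < c \<and> p i \<in> B})"
    using configuration_points[OF \<xi>(1) borel_D[of n] bounded_D[of n]] by blast
  note p = this[rule_format]
  obtain e where e: "0 < e" "ball (\<integral>x. f x \<partial>\<xi>) e \<subseteq> U"
    using openE[OF U \<xi>(2)] by blast
  \<comment> \<open>Both integrals lie within \<open>real c * \<delta>\<close> of the same sum; the
    1 in the denominator makes \<open>2 * real c * \<delta> < e\<close> strict and admits
    \<open>c = 0\<close>.\<close>
  define \<delta> where "\<delta> = e / (2 * real c + 1)"
  have \<delta>: "0 < \<delta>" using e(1) by (simp add: \<delta>_def)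
  define X where "X = p ` {..<c}"
  have "finite X" by (simp add: X_def)
  moreover have "open {y. dist (f y) (f x) < \<delta>} \<and> x \<in> {y. dist (f y) (f x) < \<delta>}" for x
    using \<delta> cont by (auto intro!: open_Collect_less continuous_intros)
  ultimately obtain k where k: "\<And>x. x \<in> X \<Longrightarrow> x \<in> V (k x) \<and> V (k x) \<subseteq> {y. dist (f y) (f x) < \<delta>}"
    and disj: "disjoint_family_on (\<lambda>x. V (k x)) X"
    using separating_basis_sets[of X "\<lambda>x. {y. dist (f y) (f x) < \<delta>}"] by blast
  obtain i0 where i0: "V i0 = UNIV" using UNIV_V by auto
  define m where "m x = card {i. i < c \<and> p i \<in> V (k x)}" for x
  define I where "I p' x = {i. i < c \<and> p' i \<in> V (k x)}" for p' x
  have finI: "finite (I p' x)" for p' x by (simp add: I_def)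
  have disjI: "\<forall>x\<in>X. \<forall>y\<in>X. x \<noteq> y \<longrightarrow> I p' x \<inter> I p' y = {}" for p'
    using disj by (auto simp: I_def disjoint_family_on_def)
  have "(\<Union>x\<in>X. I p x) = {..<c}" using k by (auto simp: I_def X_def)
  then have sum_m: "(\<Sum>x\<in>X. m x) = c"
    using card_UN_disjoint[OF \<open>finite X\<close> _ disjI[of p]] finI by (simp add: m_def I_def)
  have approx: "\<bar>(\<Sum>i<c. f (p' i)) - (\<Sum>x\<in>X. real (m x) * f x)\<bar> \<le> real c * \<delta>"
    if p': "\<And>x. x \<in> X \<Longrightarrow> card (I p' x) = m x" for p'
  proof -
    \<comment> \<open>The counts in the disjoint basis sets already add up to \<open>c\<close>, so
      no point is left outside them.\<close>
    have "card (\<Union>x\<in>X. I p' x) = c"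
      using card_UN_disjoint[OF \<open>finite X\<close> _ disjI[of p']] finI p' sum_m by simp
    moreover have "(\<Union>x\<in>X. I p' x) \<subseteq> {..<c}" by (auto simp: I_def)
    ultimately have un: "(\<Union>x\<in>X. I p' x) = {..<c}" using card_subset_eq[of "{..<c}"] by simp
    have "(\<Sum>i<c. f (p' i)) = (\<Sum>x\<in>X. \<Sum>i\<in>I p' x. f (p' i))"
      unfolding un[symmetric] using finI disjI \<open>finite X\<close> by (intro sum.UNION_disjoint) auto
    also have "\<dots> - (\<Sum>x\<in>X. real (m x) * f x) = (\<Sum>x\<in>X. \<Sum>i\<in>I p' x. f (p' i) - f x)"
      using p' by (simp add: sum_subtractf)
    also have "\<bar>\<dots>\<bar> \<le> (\<Sum>x\<in>X. \<Sum>i\<in>I p' x. \<delta>)"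
    proof (intro sum_norm_le[where 'a=real, unfolded real_norm_def] sum_norm_le)
      fix x i assume "x \<in> X" "i \<in> I p' x"
      then have "dist (f (p' i)) (f x) < \<delta>" using k by (force simp: I_def)
      then show "\<bar>f (p' i) - f x\<bar> \<le> \<delta>" by (simp add: dist_real_def)
    qed
    also have "\<dots> = (\<Sum>x\<in>X. real (m x)) * \<delta>" using p' by (simp add: sum_distrib_right)
    also have "\<dots> = real c * \<delta>" using sum_m by (metis of_nat_sum)
    finally show ?thesis .
  qed
  define W where "W = {h :: nat \<times> nat \<Rightarrow> real. \<bar>h (i0, n) - real c\<bar> < 1} \<inter>
     (\<Inter>x\<in>X. {h. \<bar>h (k x, n) - real (m x)\<bar> < 1})"
  have "open W" unfolding W_def using \<open>finite X\<close>
    by (intro open_Int open_INT ballI open_Collect_less continuous_intros) auto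
  have cnt: "npoints \<xi> (V i \<inter> D n) = card {j. j < c \<and> p j \<in> V i}" for i
    using p(2)[of "V i"] by (intro npoints_eqI) auto
  have "profile \<xi> \<in> W"
    using cnt[of i0] by (auto simp: W_def profile_npoints[OF \<xi>(1)] cnt i0 m_def)
  moreover have "(\<integral>x. f x \<partial>\<zeta>) \<in> U" if \<zeta>: "\<zeta> \<in> configurations" "profile \<zeta> \<in> W" for \<zeta>
  proof -
    obtain c' p' where "\<forall>i<c'. p' i \<in> D n"
      "\<forall>B\<in>sets borel. emeasure \<zeta> (B \<inter> D n) = of_nat (card {i::nat. i < c' \<and> p' i \<in> B})"
      using configuration_points[OF \<zeta>(1) borel_D[of n] bounded_D[of n]] by blast
    note p' = this[rule_format]
    have cnt': "npoints \<zeta> (V i \<inter> D n) = card {j. j < c' \<and> p' j \<in> V i}" for i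
      using p'(2)[of "V i"] by (intro npoints_eqI) auto
    have "\<bar>real c' - real c\<bar> < 1"
      using \<zeta>(2) cnt'[of i0] by (simp add: W_def profile_npoints[OF \<zeta>(1)] i0)
    then have c': "c' = c" by linarith
    have I': "card (I p' x) = m x" if "x \<in> X" for x
    proof -
      have "\<bar>real (card (I p' x)) - real (m x)\<bar> < 1"
        using \<zeta>(2) that by (simp add: W_def profile_npoints[OF \<zeta>(1)] cnt' I_def c')
      then show ?thesis by linarith
    qed
    have "(\<integral>x. f x \<partial>\<zeta>) = (\<Sum>i<c. f (p' i))"
      using integral_configuration[OF \<zeta>(1) borel_D _ f0 p'(2)] c' by simp
    moreover have "(\<integral>x. f x \<partial>\<xi>) = (\<Sum>i<c. f (p i))"
      using integral_configuration[OF \<xi>(1) borel_D _ f0 p(2)] by simp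
    moreover have "\<bar>(\<Sum>i<c. f (p i)) - (\<Sum>i<c. f (p' i))\<bar> \<le> 2 * real c * \<delta>"
      using approx[of p'] approx[of p] I' by (simp add: m_def I_def)
    moreover have "2 * real c * \<delta> < e" using e(1) by (simp add: \<delta>_def field_simps)
    ultimately have "(\<integral>x. f x \<partial>\<zeta>) \<in> ball (\<integral>x. f x \<partial>\<xi>) e" by (simp add: dist_real_def)
    then show ?thesis using e(2) by blast
  qed
  ultimately show ?thesis using \<open>open W\<close> by blast
qed

text \<open>Profiles carry at least the information of the vague topology, and possibly more, since
  the count of an open set may jump in a vague limit. The induction follows the generation of the
  topology.\<close>

lemma vague_open_profile:
  assumes "openin vague_topology (U :: 'a measure set)"
  shows "\<exists>W. open W \<and> U = {\<xi> \<in> configurations. profile \<xi> \<in> W}"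
  using assms unfolding vague_topology_def openin_topology_generated_by_iff
proof induction
  case Empty
  then show ?case by (intro exI[of _ "{}"]) auto
next
  case (Int A B)
  then obtain W W' where "open W" "A = {\<xi> \<in> configurations. profile \<xi> \<in> W}"
    "open W'" "B = {\<xi> \<in> configurations. profile \<xi> \<in> W'}" by blast
  then show ?case by (intro exI[of _ "W \<inter> W'"]) auto
next
  case (UN K)
  then obtain W where "\<And>k. k \<in> K \<Longrightarrow> open (W k) \<and> k = {\<xi> \<in> configurations. profile \<xi> \<in> W k}" by metis
  then show ?case by (intro exI[of _ "\<Union>k\<in>K. W k"]) blast
next
  case (Basis s)
  then obtain f U where s: "s = {\<xi> \<in> configurations. (\<integral>x. f x \<partial>\<xi>) \<in> U}"
    and fU: "f \<in> vague_test_functions" "open U" by blast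
  \<comment> \<open>The largest candidate: the union of all open sets of profiles that force the
    integral into \<open>U\<close>. By \<open>vague_subbasis_profile\<close> it contains the profile
    of every element of \<open>s\<close>.\<close>
  let ?W = "\<Union>{W. open W \<and> (\<forall>\<zeta>\<in>configurations. profile \<zeta> \<in> W \<longrightarrow> (\<integral>x. f x \<partial>\<zeta>) \<in> U)}"
  have "s = {\<xi> \<in> configurations. profile \<xi> \<in> ?W}"
  proof (intro subset_antisym subsetI)
    fix \<xi> assume "\<xi> \<in> s"
    then have \<xi>: "\<xi> \<in> configurations" "(\<integral>x. f x \<partial>\<xi>) \<in> U" by (auto simp: s)
    obtain W where "open W" "profile \<xi> \<in> W" "\<forall>\<zeta>\<in>configurations. profile \<zeta> \<in> W \<longrightarrow> (\<integral>x. f x \<partial>\<zeta>) \<in> U"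
      using vague_subbasis_profile[OF fU \<xi>] by blast
    then show "\<xi> \<in> {\<xi> \<in> configurations. profile \<xi> \<in> ?W}" using \<xi>(1) by blast
  qed (auto simp: s)
  moreover have "open ?W" by auto
  ultimately show ?case by blast
qed

lemma space_configuration_space: "space (configuration_space :: 'a measure measure) = configurations"
  and sets_configuration_space:
    "sets (configuration_space :: 'a measure measure) = sigma_sets configurations {U. openin vague_topology U}"
proof -
  have "{U. openin vague_topology U} \<subseteq> Pow (configurations :: 'a measure set)"
    using vague_open_profile by blast
  then show "space (configuration_space :: 'a measure measure) = configurations"
    "sets (configuration_space :: 'a measure measure) = sigma_sets configurations {U. openin vague_topology U}"
    by (simp_all add: configuration_space_def)
qed

lemma configuration_space_profile:
  assumes "A \<in> sets (configuration_space :: 'a measure measure)"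
  shows "\<exists>B\<in>sets borel. A = {\<xi> \<in> configurations. profile \<xi> \<in> B}"
  using assms unfolding sets_configuration_space
proof induction
  case (Basic a)
  then obtain W where "open W" "a = {\<xi> \<in> configurations. profile \<xi> \<in> W}" using vague_open_profile by blast
  then show ?case by (intro bexI[of _ W]) auto
next
  case Empty
  show ?case by (intro bexI[of _ "{}"]) auto
next
  case (Compl a)
  then obtain B where "B \<in> sets borel" "a = {\<xi> \<in> configurations. profile \<xi> \<in> B}" by blast
  then show ?case by (intro bexI[of _ "- B"]) auto
next
  case (Union a)
  then obtain B where "\<And>i::nat. B i \<in> sets borel \<and> a i = {\<xi> \<in> configurations. profile \<xi> \<in> B i}" by metis
  then show ?case by (intro bexI[of _ "\<Union>i. B i"]) auto
qed

end

section \<open>Compact approximation\<close>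

text \<open>Restriction to \<open>A\<close> makes the measure finite, so
  \<open>inner_regular\<close> applies. If every compact subset missed mass at least
  \<open>\<delta>\<close>, the supremum of their masses would fall short of the finite mass of
  \<open>A\<close>.\<close>

lemma inner_compact_approx:
  fixes \<nu> :: "'a::polish_space measure"
  assumes \<nu>: "sets \<nu> = sets borel" and A: "A \<in> sets borel" "emeasure \<nu> A < \<infinity>" and "0 < \<delta>"
  shows "\<exists>K. compact K \<and> K \<subseteq> A \<and> emeasure \<nu> (A - K) \<le> ennreal \<delta>"
proof (rule ccontr)
  assume *: "\<not> ?thesis"
  let ?M = "density \<nu> (indicator A)"
  have em': "emeasure ?M B = emeasure \<nu> (A \<inter> B)" if "B \<in> sets borel" for B
    using that A \<nu> by (subst emeasure_density) (auto simp flip: indicator_inter_arith)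
  have em: "emeasure ?M B = emeasure \<nu> B" if "B \<in> sets borel" "B \<subseteq> A" for B
    using em'[OF that(1)] Int_absorb1[OF that(2)] by simp
  have "space ?M = UNIV" using sets_eq_imp_space_eq[OF \<nu>] by simp
  then have "emeasure ?M (space ?M) = emeasure \<nu> A" using em'[of UNIV] by simp
  then have "emeasure ?M A = (SUP K\<in>{K. K \<subseteq> A \<and> compact K}. emeasure ?M K)"
    using A \<nu> by (intro inner_regular) (auto simp: less_top[symmetric])
  then have reg: "emeasure \<nu> A = (SUP K\<in>{K. K \<subseteq> A \<and> compact K}. emeasure \<nu> K)"
    using A em[OF _ subset_refl] em[OF borel_compact] by (simp cong: SUP_cong_simp)
  have "emeasure \<nu> K + ennreal \<delta> \<le> emeasure \<nu> A" if "K \<subseteq> A" "compact K" for K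
  proof -
    have "K \<in> sets borel" using that borel_compact by auto
    then have "emeasure \<nu> A = emeasure \<nu> K + emeasure \<nu> (A - K)"
      using that A \<nu> by (subst plus_emeasure) (auto simp: Un_absorb1)
    moreover have "ennreal \<delta> \<le> emeasure \<nu> (A - K)" using * that linear by blast
    ultimately show ?thesis by (simp add: add_left_mono)
  qed
  then have "(SUP K\<in>{K. K \<subseteq> A \<and> compact K}. emeasure \<nu> K + ennreal \<delta>) \<le> emeasure \<nu> A"
    by (intro SUP_least) auto
  also have "(SUP K\<in>{K. K \<subseteq> A \<and> compact K}. emeasure \<nu> K + ennreal \<delta>) = emeasure \<nu> A + ennreal \<delta>"
    unfolding reg by (intro ennreal_SUP_add_left) auto
  finally show False
    using A(2) \<open>0 < \<delta>\<close> by (cases "emeasure \<nu> A" rule: ennreal_cases) (auto simp flip: ennreal_plus)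
qed

lemma emeasure_UN_geometric_le:
  assumes "range S \<subseteq> sets M" "0 \<le> \<delta>" "\<And>i::nat. emeasure M (S i) \<le> ennreal (\<delta> * (1 / 2) ^ Suc i)"
  shows "emeasure M (\<Union>i. S i) \<le> ennreal \<delta>"
proof -
  have "emeasure M (\<Union>i. S i) \<le> (\<Sum>i. emeasure M (S i))"
    using assms(1) by (rule emeasure_subadditive_countably)
  also have "\<dots> \<le> (\<Sum>i. ennreal (\<delta> * (1 / 2) ^ Suc i))"
    by (intro suminf_le assms(3)) auto
  also have "\<dots> = ennreal \<delta>"
    using assms(2) sums_mult[OF power_half_series, of \<delta>] by (intro suminf_ennreal_eq) auto
  finally show ?thesis .
qed

lemma convergent_nat_eventually_const:
  fixes c :: "nat \<Rightarrow> nat"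
  assumes "(\<lambda>m. real (c m)) \<longlonglongrightarrow> L"
  shows "\<exists>N. \<forall>\<^sub>F m in sequentially. c m = N"
proof -
  obtain M where M: "\<And>m. M \<le> m \<Longrightarrow> dist (real (c m)) L < 1 / 2"
    using assms unfolding lim_sequentially by (meson half_gt_zero zero_less_one)
  have "c m = c M" if "M \<le> m" for m
    using M[OF that] M[of M] unfolding dist_real_def by linarith
  then show ?thesis unfolding eventually_sequentially by blast
qed

lemma compact_Pi_UNIV:
  fixes S :: "'i \<Rightarrow> 'b::topological_space set"
  assumes "\<And>i. compact (S i)"
  shows "compact {f. \<forall>i. f i \<in> S i}"
proof -
  have "compactin (product_topology (\<lambda>i. euclidean) UNIV) (PiE UNIV S)"
    unfolding compactin_PiE using assms by (simp add: compactin_euclidean_iff)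
  then show ?thesis
    by (simp add: euclidean_product_topology compactin_euclidean_iff PiE_UNIV_domain Pi_def)
qed

lemma tendsto_coordinate:
  assumes "(f \<longlongrightarrow> (l :: 'i \<Rightarrow> 'b::topological_space)) F"
  shows "((\<lambda>x. f x i) \<longlongrightarrow> l i) F"
  using continuous_on_tendsto_compose[OF continuous_on_product_coordinates[of i] assms] by simp

context counting_basis
begin

text \<open>Membership in each ball \<open>D m\<close> is constant on an annulus, so points confined
  to a compact subset of it keep their ball memberships in the limit, whereas points outside a
  closed ball may converge into it.\<close>

definition annulus :: "nat \<Rightarrow> 'a set" where "annulus n = D n - (\<Union>m<n. D m)"

lemma borel_annulus [measurable]: "annulus n \<in> sets borel"
  unfolding annulus_def by measurable

lemma bounded_annulus: "bounded (annulus n)"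
  using bounded_subset[OF bounded_D] by (auto simp: annulus_def)

lemma annulus_in_D_iff: "x \<in> annulus n \<Longrightarrow> x \<in> D m \<longleftrightarrow> n \<le> m"
  unfolding annulus_def using D_mono by (cases "n \<le> m") auto

lemma D_eq_UN_annulus: "D n = (\<Union>m\<le>n. annulus m)"
proof (intro subset_antisym subsetI)
  fix x assume x: "x \<in> D n"
  let ?m = "LEAST m. x \<in> D m"
  have "x \<in> D ?m" using x by (rule LeastI)
  moreover have "x \<notin> D m" if "m < ?m" for m using not_less_Least[OF that] .
  ultimately have "x \<in> annulus ?m" unfolding annulus_def by blast
  moreover have "?m \<le> n" using x by (rule Least_le)
  ultimately show "x \<in> (\<Union>m\<le>n. annulus m)" by blast
qed (auto simp: annulus_in_D_iff)

lemma disjoint_annulus: "m \<noteq> n \<Longrightarrow> annulus m \<inter> annulus n = {}"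
  using annulus_in_D_iff by (metis disjoint_iff le_antisym order_refl)

text \<open>In the style of Lusin's theorem: for each \<open>i\<close>, compact sets
  \<open>C i\<close> inside \<open>A \<inter> V i\<close> and \<open>E i\<close> inside
  \<open>A - V i\<close> together lose at most \<open>\<delta> * (1 / 2) ^ Suc i\<close>. On the
  intersection \<open>K\<close> of all \<open>C i \<union> E i\<close>, the trace of
  \<open>V i\<close> is that of \<open>C i\<close>, so it is closed as well as relatively open, and
  belonging to \<open>V i\<close> is a continuous property on \<open>K\<close>.\<close>

lemma compact_approx_closed_traces:
  assumes \<nu>: "sets \<nu> = sets borel" and A: "A \<in> sets borel" "emeasure \<nu> A < \<infinity>" and \<delta>: "0 < \<delta>"
  shows "\<exists>K. compact K \<and> K \<subseteq> A \<and> emeasure \<nu> (A - K) \<le> ennreal \<delta> \<and> (\<forall>i. closed (K \<inter> V i))"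
proof -
  have [measurable_cong]: "sets \<nu> = sets borel" by fact
  have "\<exists>C E. compact C \<and> C \<subseteq> A \<inter> V i \<and> compact E \<and> E \<subseteq> A - V i \<and>
      emeasure \<nu> (A - (C \<union> E)) \<le> ennreal (\<delta> * (1 / 2) ^ Suc i)" for i
  proof -
    let ?\<delta> = "\<delta> * (1 / 2) ^ Suc i / 2"
    have fin: "emeasure \<nu> (A \<inter> V i) < \<infinity>" "emeasure \<nu> (A - V i) < \<infinity>"
      using A emeasure_mono[of "A \<inter> V i" A \<nu>] emeasure_mono[of "A - V i" A \<nu>] \<nu> by (auto simp: less_top[symmetric] top_unique)
    obtain C where C: "compact C" "C \<subseteq> A \<inter> V i" "emeasure \<nu> (A \<inter> V i - C) \<le> ennreal ?\<delta>"
      using inner_compact_approx[OF \<nu> _ fin(1), of ?\<delta>] A \<delta> by auto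
    obtain E where E: "compact E" "E \<subseteq> A - V i" "emeasure \<nu> (A - V i - E) \<le> ennreal ?\<delta>"
      using inner_compact_approx[OF \<nu> _ fin(2), of ?\<delta>] A \<delta> by auto
    have CE[measurable]: "C \<in> sets borel" "E \<in> sets borel" using C(1) E(1) borel_compact by auto
    have "A - (C \<union> E) \<subseteq> (A \<inter> V i - C) \<union> (A - V i - E)" by auto
    then have "emeasure \<nu> (A - (C \<union> E)) \<le> emeasure \<nu> ((A \<inter> V i - C) \<union> (A - V i - E))"
      using A CE \<nu> by (intro emeasure_mono) auto
    also have "\<dots> \<le> emeasure \<nu> (A \<inter> V i - C) + emeasure \<nu> (A - V i - E)"
      using A CE \<nu> by (intro emeasure_subadditive) auto
    also have "\<dots> \<le> ennreal ?\<delta> + ennreal ?\<delta>" using C E by (intro add_mono)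
    also have "\<dots> = ennreal (\<delta> * (1 / 2) ^ Suc i)" using \<delta> by (simp flip: ennreal_plus)
    finally show ?thesis using C E by blast
  qed
  then obtain C E where CE: "\<And>i. compact (C i)" "\<And>i. C i \<subseteq> A \<inter> V i" "\<And>i. compact (E i)" "\<And>i. E i \<subseteq> A - V i"
     "\<And>i. emeasure \<nu> (A - (C i \<union> E i)) \<le> ennreal (\<delta> * (1 / 2) ^ Suc i)" by metis
  define K where "K = (\<Inter>i. C i \<union> E i)"
  have cl: "closed (C i)" "closed (E i)" for i using CE(1,3) compact_imp_closed by auto
  have clK: "closed K" unfolding K_def using cl by (intro closed_INT) auto
  have "K = (C 0 \<union> E 0) \<inter> K" by (auto simp: K_def)
  then have "compact K" using clK CE(1,3) by (metis compact_Int_closed compact_Un)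
  moreover have "K \<subseteq> A" using CE(2,4) by (force simp: K_def)
  moreover have "emeasure \<nu> (A - K) \<le> ennreal \<delta>"
  proof -
    have "A - K = (\<Union>i. A - (C i \<union> E i))" by (auto simp: K_def)
    moreover have "A - (C i \<union> E i) \<in> sets \<nu>" for i
      using A cl[of i] \<nu> by auto
    ultimately show ?thesis
      using emeasure_UN_geometric_le[of "\<lambda>i. A - (C i \<union> E i)" \<nu> \<delta>] CE(5) \<delta> by auto
  qed
  moreover have "closed (K \<inter> V i)" for i
  proof -
    have "K \<subseteq> C i \<union> E i" by (auto simp: K_def)
    then have "K \<inter> V i = K \<inter> C i" using CE(2,4)[of i] by auto
    then show ?thesis using clK cl by auto
  qed
  ultimately show ?thesis by blast
qed

lemma points_in_compact_part:
  assumes \<zeta>: "\<zeta> \<in> configurations" and K: "compact K" "K \<subseteq> annulus n" "emeasure \<zeta> (annulus n - K) = 0"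
  shows "\<exists>(c::nat) p. (\<forall>j<c. p j \<in> K) \<and>
    (\<forall>B\<in>sets borel. npoints \<zeta> (B \<inter> annulus n) = card {j. j < c \<and> p j \<in> B})"
proof -
  have Kb[measurable]: "K \<in> sets borel" using K(1) borel_compact by auto
  obtain c p where p: "\<forall>j<c. p j \<in> K"
    "\<forall>B\<in>sets borel. emeasure \<zeta> (B \<inter> K) = of_nat (card {j::nat. j < c \<and> p j \<in> B})"
    using configuration_points[OF \<zeta> Kb compact_imp_bounded[OF K(1)]] by blast
  have "npoints \<zeta> (B \<inter> annulus n) = card {j. j < c \<and> p j \<in> B}" if B: "B \<in> sets borel" for B
  proof (rule npoints_eqI)
    have "B \<inter> annulus n = (B \<inter> K) \<union> (B \<inter> (annulus n - K))" using K(2) by auto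
    moreover have "emeasure \<zeta> (B \<inter> (annulus n - K)) = 0"
      using emeasure_mono[of "B \<inter> (annulus n - K)" "annulus n - K" \<zeta>] K(3) Kb B
      by (auto simp: configuration_sets[OF \<zeta>])
    ultimately have "emeasure \<zeta> (B \<inter> annulus n) = emeasure \<zeta> (B \<inter> K)"
      using Kb B by (simp add: configuration_sets[OF \<zeta>] emeasure_Un_null_set null_setsI)
    then show "emeasure \<zeta> (B \<inter> annulus n) = of_nat (card {j. j < c \<and> p j \<in> B})" using p(2) B by auto
  qed
  then show ?thesis using p(1) by blast
qed

lemma npoints_D_sum:
  assumes \<zeta>: "\<zeta> \<in> configurations" and B: "B \<in> sets borel"
  shows "npoints \<zeta> (B \<inter> D n) = (\<Sum>m\<le>n. npoints \<zeta> (B \<inter> annulus m))"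
proof (rule npoints_eqI)
  have "B \<inter> D n = (\<Union>m\<in>{..n}. B \<inter> annulus m)" by (auto simp: D_eq_UN_annulus)
  moreover have "disjoint_family_on (\<lambda>m. B \<inter> annulus m) {..n}"
    using disjoint_annulus unfolding disjoint_family_on_def by blast
  ultimately have "emeasure \<zeta> (B \<inter> D n) = (\<Sum>m\<le>n. emeasure \<zeta> (B \<inter> annulus m))"
    using B by (simp only:) (intro sum_emeasure[symmetric]; auto simp: configuration_sets[OF \<zeta>])
  also have "\<dots> = of_nat (\<Sum>m\<le>n. npoints \<zeta> (B \<inter> annulus m))"
    unfolding of_nat_sum using B \<zeta> bounded_subset[OF bounded_annulus]
    by (intro sum.cong emeasure_npoints) auto
  finally show "emeasure \<zeta> (B \<inter> D n) = of_nat (\<Sum>m\<le>n. npoints \<zeta> (B \<inter> annulus m))" .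
qed

text \<open>The counts per annulus are convergent integers, hence eventually constant. The points
  range over compact sets, so along a subsequence all of them converge at once, by Tychonoff.
  Membership in \<open>K n\<close> and in each \<open>V i\<close> passes to the limit, and the limit
  points make up \<open>\<xi>\<close>.\<close>

lemma profile_limit:
  assumes K: "\<And>n. compact (K n)" "\<And>n. K n \<subseteq> annulus n" "\<And>n i. closed (K n \<inter> V i)"
    and \<zeta>: "\<And>m::nat. \<zeta> m \<in> configurations" "\<And>m n. emeasure (\<zeta> m) (annulus n - K n) = 0"
    and lim: "\<And>j. (\<lambda>m. profile (\<zeta> m) j) \<longlonglongrightarrow> k j"
  shows "\<exists>\<xi>\<in>configurations. profile \<xi> = k"
proof -
  obtain i0 where i0: "V i0 = UNIV" using UNIV_V by auto
  define P where "P m n c p \<longleftrightarrow> (\<forall>j<c. p j \<in> K n) \<and>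
    (\<forall>B\<in>sets borel. npoints (\<zeta> m) (B \<inter> annulus n) = card {j. j < c \<and> p j \<in> B})" for m n and c :: nat and p
  have "\<exists>c p. P m n c p" for m n
    unfolding P_def by (rule points_in_compact_part[OF \<zeta>(1) K(1,2) \<zeta>(2)])
  then obtain c p where "\<And>m n. P m n (c m n) (p m n)" by metis
  then have p: "\<And>m n j. j < c m n \<Longrightarrow> p m n j \<in> K n"
    "\<And>m n B. B \<in> sets borel \<Longrightarrow> npoints (\<zeta> m) (B \<inter> annulus n) = card {j. j < c m n \<and> p m n j \<in> B}"
    by (auto simp: P_def)
  have prof: "profile (\<zeta> m) (i, n) = (\<Sum>n'\<le>n. real (card {j. j < c m n' \<and> p m n' j \<in> V i}))" for m i n
    by (simp add: profile_npoints[OF \<zeta>(1)] npoints_D_sum[OF \<zeta>(1)] p(2))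
  have "\<exists>N. \<forall>\<^sub>F m in sequentially. c m n = N" for n
  proof (rule convergent_nat_eventually_const)
    \<comment> \<open>The count in an annulus is the difference of consecutive ball counts, read off
      at \<open>V i0 = UNIV\<close>; annulus 0 is \<open>D 0\<close> itself.\<close>
    have "real (c m n) = profile (\<zeta> m) (i0, n) - (if n = 0 then 0 else profile (\<zeta> m) (i0, n - 1))" for m
      by (cases n) (auto simp: prof i0)
    then show "(\<lambda>m. real (c m n)) \<longlonglongrightarrow> k (i0, n) - (if n = 0 then 0 else k (i0, n - 1))"
      by (cases "n = 0") (auto intro!: tendsto_diff lim)
  qed
  then obtain c' where c': "\<And>n. \<forall>\<^sub>F m in sequentially. c m n = c' n" by metis
  \<comment> \<open>Indices beyond the count receive the filler \<open>z0\<close>, so that every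
    \<open>q m\<close> lies in one fixed compact product.\<close>
  define q where "q m = (\<lambda>(n, j). if j < c m n then p m n j else z0)" for m
  have "compact {f. \<forall>x :: nat \<times> nat. f x \<in> insert z0 (K (fst x))}"
    using K(1) by (intro compact_Pi_UNIV) auto
  moreover have "q m \<in> {f. \<forall>x. f x \<in> insert z0 (K (fst x))}" for m
    using p(1) by (auto simp: q_def)
  ultimately obtain l r where r: "strict_mono (r :: nat \<Rightarrow> nat)" "(q \<circ> r) \<longlonglongrightarrow> l"
    using compact_imp_seq_compact unfolding seq_compact_def by blast
  have cr: "\<forall>\<^sub>F m in sequentially. c (r m) n = c' n" for n
    using eventually_subseq[OF r(1) c'] .
  have ql: "(\<lambda>m. q (r m) (n, j)) \<longlonglongrightarrow> l (n, j)" for n j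
    using tendsto_coordinate[OF r(2), of "(n, j)"] by (simp add: o_def)
  have qK: "\<forall>\<^sub>F m in sequentially. q (r m) (n, j) = p (r m) n j \<and> q (r m) (n, j) \<in> K n" if "j < c' n" for n j
    using cr[of n] by eventually_elim (use that p(1) in \<open>auto simp: q_def\<close>)
  have lK: "l (n, j) \<in> K n" if "j < c' n" for n j
    by (rule Lim_in_closed_set[OF compact_imp_closed[OF K(1)] _ _ ql])
       (use qK[OF that] in \<open>auto elim: eventually_mono\<close>)
  \<comment> \<open>A limit inside \<open>V i\<close> is handled by openness of \<open>V i\<close>;
    a limit outside by closedness of \<open>K n \<inter> V i\<close>, since the points stay in
    \<open>K n\<close>.\<close>
  have lV: "\<forall>\<^sub>F m in sequentially. p (r m) n j \<in> V i \<longleftrightarrow> l (n, j) \<in> V i" if "j < c' n" for n j i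
  proof (cases "l (n, j) \<in> V i")
    case True
    have "\<forall>\<^sub>F m in sequentially. q (r m) (n, j) \<in> V i" using topological_tendstoD[OF ql open_V True] .
    with qK[OF that] show ?thesis by eventually_elim (use True in auto)
  next
    case False
    have "\<forall>\<^sub>F m in sequentially. q (r m) (n, j) \<in> - (K n \<inter> V i)"
      using False open_Compl[OF K(3)[of n i]] by (intro topological_tendstoD[OF ql]) auto
    with qK[OF that] show ?thesis by eventually_elim (use False in auto)
  qed
  define J where "J = {(n, j). j < c' n}"
  have finJ: "finite {x \<in> J. fst x \<le> n}" for n
    by (rule finite_subset[of _ "Sigma {..n} (\<lambda>n. {..<c' n})"]) (auto simp: J_def)
  \<comment> \<open>Local finiteness: the limits in row \<open>n\<close> lie in annulus
    \<open>n\<close>, so \<open>D n\<close> meets only the rows up to \<open>n\<close>, each of them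
    finite.\<close>
  have J_D: "{x \<in> J. l x \<in> D n} = {x \<in> J. fst x \<le> n}" for n
  proof -
    have "l x \<in> D n \<longleftrightarrow> fst x \<le> n" if "x \<in> J" for x
      using that lK[of "snd x" "fst x"] K(2) annulus_in_D_iff by (force simp: J_def)
    then show ?thesis by auto
  qed
  have fin: "finite {x \<in> J. l x \<in> cball z R}" for z R
  proof -
    obtain N where "cball z R \<subseteq> D N" using bounded_imp_subset_D[OF bounded_cball] .
    then have "{x \<in> J. l x \<in> cball z R} \<subseteq> {x \<in> J. l x \<in> D N}" by blast
    then show ?thesis using finJ[of N] finite_subset unfolding J_D by blast
  qed
  define \<xi> where "\<xi> = distr (count_space J) borel l"
  have \<xi>: "\<xi> \<in> configurations" unfolding \<xi>_def using point_configuration(1)[OF fin] .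
  have prof_\<xi>: "profile \<xi> (i, n) = (\<Sum>n'\<le>n. real (card {j. j < c' n' \<and> l (n', j) \<in> V i}))" for i n
  proof -
    have b: "bounded (V i \<inter> D n)" using bounded_subset[OF bounded_D] by blast
    have "npoints \<xi> (V i \<inter> D n) = card {x \<in> J. l x \<in> V i \<inter> D n}"
      unfolding \<xi>_def using b by (intro npoints_eqI point_configuration(2)[OF fin]) auto
    also have "{x \<in> J. l x \<in> V i \<inter> D n} = Sigma {..n} (\<lambda>n'. {j. j < c' n' \<and> l (n', j) \<in> V i})"
    proof -
      have "{x \<in> J. l x \<in> V i \<inter> D n} = {x \<in> J. fst x \<le> n \<and> l x \<in> V i}" using J_D[of n] by blast
      also have "\<dots> = Sigma {..n} (\<lambda>n'. {j. j < c' n' \<and> l (n', j) \<in> V i})" by (auto simp: J_def)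
      finally show ?thesis .
    qed
    also have "card \<dots> = (\<Sum>n'\<le>n. card {j. j < c' n' \<and> l (n', j) \<in> V i})"
      by (subst card_SigmaI) auto
    finally show ?thesis by (simp add: profile_npoints[OF \<xi>])
  qed
  have "profile \<xi> (i, n) = k (i, n)" for i n
  proof -
    have "\<forall>\<^sub>F m in sequentially. \<forall>n'\<in>{..n}. c (r m) n' = c' n' \<and>
        (\<forall>j\<in>{..<c' n'}. p (r m) n' j \<in> V i \<longleftrightarrow> l (n', j) \<in> V i)"
      using cr lV by (intro eventually_ball_finite eventually_conj ballI) auto
    then have "\<forall>\<^sub>F m in sequentially. profile (\<zeta> (r m)) (i, n) = profile \<xi> (i, n)"
    proof eventually_elim
      case (elim m)
      have "{j. j < c (r m) n' \<and> p (r m) n' j \<in> V i} = {j. j < c' n' \<and> l (n', j) \<in> V i}" if "n' \<le> n" for n'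
        using elim that by auto
      then show ?case unfolding prof prof_\<xi> by (intro sum.cong) auto
    qed
    then have "(\<lambda>m. profile (\<zeta> (r m)) (i, n)) \<longlonglongrightarrow> profile \<xi> (i, n)"
      by (rule tendsto_eventually)
    moreover have "(\<lambda>m. profile (\<zeta> (r m)) (i, n)) \<longlonglongrightarrow> k (i, n)"
      using LIMSEQ_subseq_LIMSEQ[OF lim r(1)] by (simp add: o_def)
    ultimately show ?thesis using LIMSEQ_unique by blast
  qed
  then show ?thesis using \<xi> by (intro bexI[of _ \<xi>]) auto
qed

end

section \<open>Probability lost by passing to a compact part of \<open>A\<close>\<close>

lemma poisson_process_single:
  assumes "poisson_point_process M \<nu> \<eta>" "S \<in> sets borel" "emeasure \<nu> S < \<infinity>"
  shows "poisson_distributed M (\<lambda>\<omega>. emeasure (\<eta> \<omega>) S) (measure \<nu> S)"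
  using assms(1)[unfolded poisson_point_process_def, THEN conjunct2, rule_format, of 1 "\<lambda>_. S"] assms(2,3)
  by (auto simp: disjoint_family_on_def)

text \<open>A Poisson variable of mean t is nonzero with probability 1 - exp(-t) \<le> t, which
  turns small intensity into small probability.\<close>

lemma poisson_process_nonvoid:
  assumes M: "prob_space M" and \<eta>: "poisson_point_process M \<nu> \<eta>" and S: "S \<in> sets borel" "emeasure \<nu> S < \<infinity>"
  shows "emeasure M {\<omega> \<in> space M. emeasure (\<eta> \<omega>) S \<noteq> 0} \<le> emeasure \<nu> S"
proof -
  interpret prob_space M by fact
  have P: "poisson_distributed M (\<lambda>\<omega>. emeasure (\<eta> \<omega>) S) (measure \<nu> S)"
    using poisson_process_single[OF \<eta> S] .
  then have [measurable]: "(\<lambda>\<omega>. emeasure (\<eta> \<omega>) S) \<in> borel_measurable M" by (simp add: poisson_distributed_def)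
  have zero: "prob {\<omega> \<in> space M. emeasure (\<eta> \<omega>) S = 0} = exp (- measure \<nu> S)"
    using P[unfolded poisson_distributed_def, THEN conjunct2, rule_format, of 0] by simp
  have "prob {\<omega> \<in> space M. emeasure (\<eta> \<omega>) S \<noteq> 0} = 1 - prob {\<omega> \<in> space M. emeasure (\<eta> \<omega>) S = 0}"
    by (intro prob_neg) auto
  also have "\<dots> \<le> measure \<nu> S" using zero exp_ge_add_one_self[of "- measure \<nu> S"] by simp
  finally show ?thesis using S(2) by (simp add: emeasure_eq_measure emeasure_eq_ennreal_measure)
qed

context counting_basis
begin

text \<open>Two conditions cut \<open>A'\<close> out of \<open>A\<close>, each at a cost of at most
  \<open>\<epsilon> / 2\<close>. Profiles in the compact set \<open>L\<close> have convergent
  subsequences with limit in \<open>B\<close>; but a limit of profiles need not be the profile of a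
  configuration. That is secured by \<open>profile_limit\<close>, as no point lies outside the sets
  \<open>K n\<close>.\<close>

lemma compact_approx_configurations:
  assumes M: "prob_space M" and \<nu>: "sets \<nu> = sets borel" "\<And>z R. emeasure \<nu> (cball z R) < \<infinity>"
    and \<eta>: "poisson_point_process M \<nu> \<eta>" and A: "A \<in> sets configuration_space" and \<epsilon>: "0 < \<epsilon>"
  shows "\<exists>A'\<subseteq>A. {\<omega> \<in> space M. \<eta> \<omega> \<in> A'} \<in> sets M \<and>
    emeasure M {\<omega> \<in> space M. \<eta> \<omega> \<in> A} \<le> emeasure M {\<omega> \<in> space M. \<eta> \<omega> \<in> A'} + ennreal \<epsilon> \<and>
    (\<forall>\<zeta> :: nat \<Rightarrow> 'a measure. (\<forall>m. \<zeta> m \<in> A') \<longrightarrow>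
      (\<exists>\<xi>\<in>A. \<exists>r. strict_mono r \<and> (\<forall>j. (\<lambda>m. profile (\<zeta> (r m)) j) \<longlonglongrightarrow> profile \<xi> j)))"
proof -
  interpret prob_space M by fact
  have \<eta>_conf: "\<eta> \<omega> \<in> configurations" if "\<omega> \<in> space M" for \<omega>
    using \<eta> that measurable_space unfolding poisson_point_process_def
    by (metis space_configuration_space)
  have fin: "emeasure \<nu> S < \<infinity>" if "bounded S" "S \<in> sets borel" for S
  proof -
    obtain n where "S \<subseteq> D n" using bounded_imp_subset_D[OF \<open>bounded S\<close>] .
    then have "emeasure \<nu> S \<le> emeasure \<nu> (D n)"
      using \<nu>(1) by (intro emeasure_mono) auto
    also have "\<dots> < \<infinity>" unfolding D_def by (rule \<nu>(2))
    finally show ?thesis .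
  qed
  have meas: "(\<lambda>\<omega>. emeasure (\<eta> \<omega>) S) \<in> borel_measurable M" if "bounded S" "S \<in> sets borel" for S
    using poisson_process_single[OF \<eta> that(2) fin[OF that]] by (simp add: poisson_distributed_def)
  obtain B where B: "B \<in> sets borel" "A = {\<xi> \<in> configurations. profile \<xi> \<in> B}"
    using configuration_space_profile[OF A] by blast
  have "\<exists>K. compact K \<and> K \<subseteq> annulus n \<and> emeasure \<nu> (annulus n - K) \<le> ennreal (\<epsilon> / 2 * (1 / 2) ^ Suc n)
      \<and> (\<forall>i. closed (K \<inter> V i))" for n
    using \<epsilon> by (intro compact_approx_closed_traces \<nu>(1) fin bounded_annulus borel_annulus) auto
  then obtain K where K: "\<And>n. compact (K n)" "\<And>n. K n \<subseteq> annulus n"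
     "\<And>n. emeasure \<nu> (annulus n - K n) \<le> ennreal (\<epsilon> / 2 * (1 / 2) ^ Suc n)" "\<And>n i. closed (K n \<inter> V i)"
    by metis
  have Kb: "annulus n - K n \<in> sets borel" "bounded (annulus n - K n)" for n
    using borel_compact[OF K(1)] bounded_subset[OF bounded_annulus, of "annulus n - K n"] by auto
  define Y where "Y \<omega> = profile (\<eta> \<omega>)" for \<omega>
  have Y[measurable]: "Y \<in> borel_measurable M"
  proof (rule measurable_coordinatewise_then_product)
    fix j :: "nat \<times> nat"
    obtain i n where j: "j = (i, n)" by (cases j)
    have "(\<lambda>\<omega>. emeasure (\<eta> \<omega>) (V i \<inter> D n)) \<in> borel_measurable M"
      using bounded_subset[OF bounded_D] by (intro meas) auto
    then show "(\<lambda>\<omega>. Y \<omega> j) \<in> borel_measurable M"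
      by (simp add: Y_def profile_def j measure_def)
  qed
  let ?\<mu> = "distr M borel Y"
  have \<mu>: "emeasure ?\<mu> S = emeasure M {\<omega> \<in> space M. Y \<omega> \<in> S}" if "S \<in> sets borel" for S
    using that by (subst emeasure_distr) (auto intro!: arg_cong2[where f=emeasure])
  have "emeasure ?\<mu> B < \<infinity>" using \<mu>[OF B(1)] by (simp add: less_top[symmetric])
  then obtain L where L: "compact L" "L \<subseteq> B" "emeasure ?\<mu> (B - L) \<le> ennreal (\<epsilon> / 2)"
    using inner_compact_approx[of ?\<mu> B "\<epsilon> / 2"] B(1) \<epsilon> by auto
  have [measurable]: "L \<in> sets borel" "B \<in> sets borel" using borel_compact[OF L(1)] B(1) by auto
  define A' where "A' = {\<xi> \<in> configurations. profile \<xi> \<in> L \<and> (\<forall>n. emeasure \<xi> (annulus n - K n) = 0)}"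
  have [measurable]: "(\<lambda>\<omega>. emeasure (\<eta> \<omega>) (annulus n - K n)) \<in> borel_measurable M" for n
    using Kb by (intro meas)
  have eqA: "{\<omega> \<in> space M. \<eta> \<omega> \<in> A} = {\<omega> \<in> space M. Y \<omega> \<in> B}"
    using \<eta>_conf by (auto simp: B(2) Y_def)
  have eqA': "{\<omega> \<in> space M. \<eta> \<omega> \<in> A'} = {\<omega> \<in> space M. Y \<omega> \<in> L \<and> (\<forall>n. emeasure (\<eta> \<omega>) (annulus n - K n) = 0)}"
    using \<eta>_conf by (auto simp: A'_def Y_def)
  let ?N = "\<lambda>n. {\<omega> \<in> space M. emeasure (\<eta> \<omega>) (annulus n - K n) \<noteq> 0}"
  have "emeasure M {\<omega> \<in> space M. \<eta> \<omega> \<in> A} \<le>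
     emeasure M ({\<omega> \<in> space M. \<eta> \<omega> \<in> A'} \<union> ({\<omega> \<in> space M. Y \<omega> \<in> B - L} \<union> (\<Union>n. ?N n)))"
    unfolding eqA eqA' by (intro emeasure_mono) auto
  also have "\<dots> \<le> emeasure M {\<omega> \<in> space M. \<eta> \<omega> \<in> A'} +
     (emeasure M {\<omega> \<in> space M. Y \<omega> \<in> B - L} + emeasure M (\<Union>n. ?N n))"
    unfolding eqA' by (rule order_trans[OF emeasure_subadditive add_left_mono[OF emeasure_subadditive]]) measurable
  also have "\<dots> \<le> emeasure M {\<omega> \<in> space M. \<eta> \<omega> \<in> A'} + (ennreal (\<epsilon> / 2) + ennreal (\<epsilon> / 2))"
  proof (intro add_left_mono add_mono)
    show "emeasure M {\<omega> \<in> space M. Y \<omega> \<in> B - L} \<le> ennreal (\<epsilon> / 2)" using L(3) \<mu>[of "B - L"] by simp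
    have "emeasure M (?N n) \<le> ennreal (\<epsilon> / 2 * (1 / 2) ^ Suc n)" for n
      using poisson_process_nonvoid[OF M \<eta> Kb(1) fin[OF Kb(2,1)], of n] K(3)[of n] by (rule order_trans)
    then show "emeasure M (\<Union>n. ?N n) \<le> ennreal (\<epsilon> / 2)"
      using \<epsilon> by (intro emeasure_UN_geometric_le) auto
  qed
  also have "ennreal (\<epsilon> / 2) + ennreal (\<epsilon> / 2) = ennreal \<epsilon>" using \<epsilon> by (simp flip: ennreal_plus)
  finally have "emeasure M {\<omega> \<in> space M. \<eta> \<omega> \<in> A} \<le> emeasure M {\<omega> \<in> space M. \<eta> \<omega> \<in> A'} + ennreal \<epsilon>" .
  moreover have "{\<omega> \<in> space M. \<eta> \<omega> \<in> A'} \<in> sets M" unfolding eqA' by measurable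
  moreover have "A' \<subseteq> A" using L(2) by (auto simp: A'_def B(2))
  moreover have "\<exists>\<xi>\<in>A. \<exists>r. strict_mono r \<and> (\<forall>j. (\<lambda>m. profile (\<zeta> (r m)) j) \<longlonglongrightarrow> profile \<xi> j)"
    if \<zeta>: "\<forall>m. \<zeta> m \<in> A'" for \<zeta> :: "nat \<Rightarrow> 'a measure"
  proof -
    have "\<forall>m. profile (\<zeta> m) \<in> L" using \<zeta> by (simp add: A'_def)
    then obtain k r where r: "k \<in> L" "strict_mono (r :: nat \<Rightarrow> nat)" "((\<lambda>m. profile (\<zeta> m)) \<circ> r) \<longlonglongrightarrow> k"
      using compact_imp_seq_compact[OF L(1)] unfolding seq_compact_def by meson
    then have lim: "(\<lambda>m. profile (\<zeta> (r m)) j) \<longlonglongrightarrow> k j" for j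
      using tendsto_coordinate[OF r(3), of j] by (simp add: o_def)
    have "\<exists>\<xi>\<in>configurations. profile \<xi> = k"
      using \<zeta> by (intro profile_limit[OF K(1,2,4) _ _ lim]) (auto simp: A'_def)
    then obtain \<xi> where \<xi>: "\<xi> \<in> configurations" "profile \<xi> = k" by blast
    then have "\<xi> \<in> A" using r(1) L(2) by (auto simp: B(2))
    then show ?thesis using \<xi>(2) r(2) lim by blast
  qed
  ultimately show ?thesis by (intro exI[of _ A']) simp
qed

end

section \<open>Discretisation\<close>

lemma countable_extensional_nat:
  assumes "finite I"
  shows "countable (extensional I :: ('i \<Rightarrow> nat) set)"
proof -
  have "extensional I = PiE I (\<lambda>_. UNIV :: nat set)" by (auto simp: PiE_def)
  then show ?thesis using countable_PiE[OF assms, of "\<lambda>_. UNIV :: nat set"] by simp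
qed

lemma count_separated_antimono:
  "count_separated I r \<A> x \<Longrightarrow> \<F> \<subseteq> \<A> \<Longrightarrow> count_separated I r \<F> x"
  unfolding count_separated_def by (meson subsetD)

lemma (in prob_space) measure_limit_from_nat_into:
  assumes X: "\<And>x. X -` {x} \<inter> space M \<in> events" and S: "countable S" "S \<noteq> {}"
  shows "(\<lambda>n. prob (X -` (from_nat_into S ` {..<n}) \<inter> space M)) \<longlonglongrightarrow> prob (X -` S \<inter> space M)"
proof -
  let ?X = "\<lambda>n. X -` (from_nat_into S ` {..<n}) \<inter> space M"
  have eq: "?X n = (\<Union>i<n. X -` {from_nat_into S i} \<inter> space M)" for n by auto
  have "?X n \<in> events" for n unfolding eq using X by (intro sets.finite_UN) auto
  moreover have "incseq ?X" by (auto simp: incseq_def)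
  ultimately have "(\<lambda>n. prob (?X n)) \<longlonglongrightarrow> prob (\<Union>n. ?X n)" by (intro finite_Lim_measure_incseq) auto
  moreover have "(\<Union>n. ?X n) = X -` S \<inter> space M"
  proof -
    have "S = (\<Union>n. from_nat_into S ` {..<n})"
      unfolding image_UN[symmetric] UN_lessThan_UNIV using range_from_nat_into[OF S(2,1)] by simp
    then show ?thesis by blast
  qed
  ultimately show ?thesis by simp
qed

lemma (in prob_space) talagrand_poisson_process:
  fixes X :: "'a \<Rightarrow> 'i \<Rightarrow> nat"
  assumes I: "finite I" and m: "\<And>i. 0 \<le> m i" and "0 \<le> r"
    and X: "\<And>x. X -` {x} \<inter> space M \<in> events" "\<And>\<omega>. \<omega> \<in> space M \<Longrightarrow> X \<omega> \<in> extensional I"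
    and law: "\<And>x. x \<in> extensional I \<Longrightarrow> prob (X -` {x} \<inter> space M) = poisson_weight I m x"
    and sep: "\<And>x. x \<in> \<B> \<Longrightarrow> count_separated I r \<A> x"
  shows "prob (X -` \<A> \<inter> space M) * prob (X -` \<B> \<inter> space M) \<le> exp (- (r\<^sup>2 / 4))"
proof -
  let ?A = "\<A> \<inter> extensional I" and ?B = "\<B> \<inter> extensional I"
  have eq: "X -` S \<inter> space M = X -` (S \<inter> extensional I) \<inter> space M" for S using X(2) by auto
  show ?thesis
  proof (cases "?A = {} \<or> ?B = {}")
    case True
    then have "prob (X -` \<A> \<inter> space M) = 0 \<or> prob (X -` \<B> \<inter> space M) = 0"
      unfolding eq[of \<A>] eq[of \<B>] by (metis Int_empty_left measure_empty vimage_empty)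
    then show ?thesis by auto
  next
    case False
    have cnt: "countable ?A" "countable ?B" using countable_extensional_nat[OF I] by (auto intro: countable_subset)
    let ?F = "\<lambda>S n. from_nat_into S ` {..<n}"
    have fin: "prob (X -` F \<inter> space M) = sum (poisson_weight I m) F" if F: "finite F" "F \<subseteq> extensional I" for F
    proof -
      have "X -` F \<inter> space M = (\<Union>x\<in>F. X -` {x} \<inter> space M)" by auto
      also have "prob \<dots> = (\<Sum>x\<in>F. prob (X -` {x} \<inter> space M))"
        using X(1) F(1) by (intro finite_measure_finite_Union) (auto simp: disjoint_family_on_def)
      also have "\<dots> = sum (poisson_weight I m) F" using F(2) law by (intro sum.cong) auto
      finally show ?thesis .
    qed
    have "prob (X -` ?F ?A n \<inter> space M) * prob (X -` ?F ?B n \<inter> space M) \<le> exp (- (r\<^sup>2 / 4))" for n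
    proof -
      have A: "?F ?A n \<subseteq> ?A" and B: "?F ?B n \<subseteq> ?B" using False from_nat_into by (metis image_subsetI)+
      show ?thesis
      proof (subst (1 2) fin)
        show "sum (poisson_weight I m) (?F ?A n) * sum (poisson_weight I m) (?F ?B n) \<le> exp (- (r\<^sup>2 / 4))"
        proof (rule talagrand_poisson[OF I m \<open>0 \<le> r\<close>])
          fix x assume "x \<in> ?F ?B n"
          then have "x \<in> \<B>" using B by blast
          then show "count_separated I r (?F ?A n) x"
            using count_separated_antimono[OF sep] A by blast
        qed (use A B in auto)
      qed (use A B in auto)
    qed
    moreover have "(\<lambda>n. prob (X -` ?F ?A n \<inter> space M) * prob (X -` ?F ?B n \<inter> space M))
       \<longlonglongrightarrow> prob (X -` ?A \<inter> space M) * prob (X -` ?B \<inter> space M)"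
      using False X(1) cnt by (intro tendsto_mult measure_limit_from_nat_into) auto
    ultimately have "prob (X -` ?A \<inter> space M) * prob (X -` ?B \<inter> space M) \<le> exp (- (r\<^sup>2 / 4))"
      by (intro LIMSEQ_le_const2) auto
    then show ?thesis using eq[of \<A>] eq[of \<B>] by simp
  qed
qed

lemma finite_atoms_bounded:
  fixes \<xi> :: "'a::metric_space measure"
  assumes \<xi>: "\<xi> \<in> configurations" and S: "S \<in> sets borel" "bounded S"
  shows "finite (atoms \<xi> \<inter> S)" "atoms \<xi> \<inter> S = {} \<Longrightarrow> emeasure \<xi> S = 0"
proof -
  obtain c p where p: "\<forall>i<c. p i \<in> S"
    "\<forall>B\<in>sets borel. emeasure \<xi> (B \<inter> S) = of_nat (card {i::nat. i < c \<and> p i \<in> B})"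
    using configuration_points[OF assms] by blast
  have mass: "emeasure \<xi> {x} = of_nat (card {i. i < c \<and> p i = x})" if "x \<in> S" for x
    using bspec[OF p(2), of "{x}"] that by simp
  have "card {i. i < c \<and> p i = x} \<noteq> 0 \<longleftrightarrow> x \<in> p ` {..<c}" for x by (auto simp: card_eq_0_iff)
  moreover have "x \<in> atoms \<xi> \<longleftrightarrow> card {i. i < c \<and> p i = x} \<noteq> 0" if "x \<in> S" for x
    unfolding atoms_def mem_Collect_eq mass[OF that] by (simp add: zero_less_iff_neq_zero)
  ultimately have eq: "atoms \<xi> \<inter> S = p ` {..<c}" using p(1) by blast
  show "finite (atoms \<xi> \<inter> S)" by (simp add: eq)
  show "emeasure \<xi> S = 0" if "atoms \<xi> \<inter> S = {}"
  proof -
    have "c = 0" using that eq by auto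
    then show ?thesis using bspec[OF p(2), of UNIV] by simp
  qed
qed

lemma emeasure_single_atom:
  fixes \<xi> :: "'a::metric_space measure"
  assumes \<xi>: "\<xi> \<in> configurations" and S: "S \<in> sets borel" "bounded S" "x \<in> S" "S \<inter> atoms \<xi> \<subseteq> {x}"
  shows "npoints \<xi> S = npoints \<xi> {x}"
proof -
  have "emeasure \<xi> (S - {x}) = 0"
    using S bounded_subset[OF S(2), of "S - {x}"] by (intro finite_atoms_bounded(2)[OF \<xi>]) auto
  moreover have "S = {x} \<union> (S - {x})" using S(3) by auto
  moreover have "emeasure \<xi> ({x} \<union> (S - {x})) = emeasure \<xi> {x} + emeasure \<xi> (S - {x})"
    using S by (intro plus_emeasure[symmetric]) (auto simp: configuration_sets[OF \<xi>])
  ultimately have "emeasure \<xi> S = emeasure \<xi> {x}" by simp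
  then show ?thesis by (simp add: npoints_def measure_def)
qed

lemma nn_integral_config_diff:
  fixes \<xi> \<zeta> :: "'a::metric_space measure"
  assumes "g \<in> borel_measurable borel"
  shows "(\<integral>\<^sup>+x. ennreal (g x) \<partial>config_diff \<xi> \<zeta>)
     = (\<integral>\<^sup>+x. (emeasure \<xi> {x} - emeasure \<zeta> {x}) * ennreal (g x) \<partial>count_space (atoms \<xi>))"
  unfolding config_diff_def using assms
  by (subst nn_integral_distr) (auto simp: nn_integral_density)

lemma nn_integral_count_space_le:
  fixes h :: "'a \<Rightarrow> ennreal"
  assumes F: "\<And>j::nat. finite (F j)" "incseq F" "S = (\<Union>j. F j)" and le: "\<And>j. sum h (F j) \<le> c"
  shows "(\<integral>\<^sup>+x. h x \<partial>count_space S) \<le> c"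
proof -
  have "(\<integral>\<^sup>+x. h x \<partial>count_space S) = (\<integral>\<^sup>+x. (SUP j. h x * indicator (F j) x) \<partial>count_space S)"
  proof (rule nn_integral_cong)
    fix x assume "x \<in> space (count_space S)"
    then obtain j where "x \<in> F j" using F(3) by auto
    then have "h x \<le> (SUP j. h x * indicator (F j) x)" by (intro SUP_upper2[of j]) auto
    moreover have "(SUP j. h x * indicator (F j) x) \<le> h x" by (intro SUP_least) (auto simp: indicator_def)
    ultimately show "h x = (SUP j. h x * indicator (F j) x)" by simp
  qed
  also have "\<dots> = (SUP j. \<integral>\<^sup>+x. h x * indicator (F j) x \<partial>count_space S)"
    using F(2) by (intro nn_integral_monotone_convergence_SUP)
      (auto simp: incseq_def le_fun_def indicator_def intro!: mult_left_mono)
  also have "\<dots> \<le> c"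
  proof (rule SUP_least)
    fix j
    have "(\<integral>\<^sup>+x. h x * indicator (F j) x \<partial>count_space S) = (\<integral>\<^sup>+x. h x * indicator (F j) x \<partial>count_space (F j))"
      using F(3) by (intro nn_integral_count_space_eq) auto
    also have "\<dots> = sum h (F j)" using F(1) by (subst nn_integral_count_space_finite) auto
    finally show "(\<integral>\<^sup>+x. h x * indicator (F j) x \<partial>count_space S) \<le> c" using le by simp
  qed
  finally show ?thesis .
qed

section \<open>Cells cut out by the first basis sets\<close>

context counting_basis
begin

text \<open>A binary code of the membership pattern of \<open>x\<close> in the first
  \<open>n\<close> basis sets; equal codes mean the same atom of the finite algebra that these sets
  generate.\<close>

definition code :: "nat \<Rightarrow> 'a \<Rightarrow> nat" where
  "code n x = set_encode {i. i < n \<and> x \<in> V i}"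

definition cell :: "nat \<Rightarrow> nat \<Rightarrow> 'a set" where
  "cell n k = {x \<in> D n. code n x = k}"

text \<open>An initial segment of the naturals, the index format of
  \<open>poisson_point_process\<close>. It contains all codes; an index that is the code of no point
  gives an empty cell.\<close>

definition cell_indices :: "nat \<Rightarrow> nat set" where
  "cell_indices n = {..<Suc (set_encode {..<n})}"

definition cell_counts :: "nat \<Rightarrow> 'a measure \<Rightarrow> nat \<Rightarrow> nat" where
  "cell_counts n \<xi> = restrict (\<lambda>k. npoints \<xi> (cell n k)) (cell_indices n)"

lemma code_in_cell_indices: "code n x \<in> cell_indices n"
  unfolding code_def cell_indices_def lessThan_iff less_Suc_eq_le set_encode_def
  by (intro sum_mono2) auto

lemma code_eq_iff: "code n x = code n y \<longleftrightarrow> (\<forall>i<n. x \<in> V i \<longleftrightarrow> y \<in> V i)"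
  unfolding code_def by (subst set_encode_eq) auto

lemma cell_subset_V:
  assumes "i < n" "x \<in> V i"
  shows "cell n (code n x) \<subseteq> V i"
  using assms by (auto simp: cell_def code_eq_iff)

lemma borel_cell [measurable]: "cell n k \<in> sets borel"
proof -
  have code_iff: "code n x = k \<longleftrightarrow> {i. i < n \<and> x \<in> V i} = set_decode k" for x
    using set_encode_eq[of "{i. i < n \<and> x \<in> V i}" "set_decode k"] by (simp add: code_def)
  show ?thesis
  proof (cases "set_decode k \<subseteq> {..<n}")
    case True
    then have "{i. i < n \<and> x \<in> V i} = set_decode k \<longleftrightarrow> (\<forall>i\<in>{..<n}. x \<in> V i \<longleftrightarrow> i \<in> set_decode k)" for x
      by blast
    then have "cell n k = D n \<inter> {x \<in> space borel. \<forall>i\<in>{..<n}. x \<in> V i \<longleftrightarrow> i \<in> set_decode k}"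
      unfolding cell_def code_iff by (simp only: space_borel) blast
    also have "\<dots> \<in> sets borel" by measurable
    finally show ?thesis .
  next
    case False
    then have "code n x \<noteq> k" for x unfolding code_iff by blast
    then have "cell n k = {}" by (auto simp: cell_def)
    then show ?thesis by simp
  qed
qed

lemma bounded_cell: "bounded (cell n k)"
  by (rule bounded_subset[OF bounded_D[of n]]) (auto simp: cell_def)

lemma disjoint_cells: "disjoint_family_on (cell n) I"
  by (auto simp: disjoint_family_on_def cell_def)

lemma cell_counts_law:
  assumes M: "prob_space M" and \<nu>: "sets \<nu> = sets borel" "\<And>z R. emeasure \<nu> (cball z R) < \<infinity>"
    and \<eta>: "poisson_point_process M \<nu> \<eta>"
  shows "(\<lambda>\<omega>. cell_counts n (\<eta> \<omega>)) -` {x} \<inter> space M \<in> sets M"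
    and "x \<in> extensional (cell_indices n) \<Longrightarrow> measure M ((\<lambda>\<omega>. cell_counts n (\<eta> \<omega>)) -` {x} \<inter> space M)
      = poisson_weight (cell_indices n) (\<lambda>k. measure \<nu> (cell n k)) x"
proof -
  interpret prob_space M by fact
  let ?I = "cell_indices n" and ?X = "\<lambda>\<omega>. cell_counts n (\<eta> \<omega>)"
  let ?Z = "\<lambda>k \<omega>. emeasure (\<eta> \<omega>) (cell n k)"
  have \<eta>_conf: "\<eta> \<omega> \<in> configurations" if "\<omega> \<in> space M" for \<omega>
    using \<eta> that measurable_space unfolding poisson_point_process_def
    by (metis space_configuration_space)
  have fin: "emeasure \<nu> (cell n k) < \<infinity>" for k
  proof -
    have "emeasure \<nu> (cell n k) \<le> emeasure \<nu> (D n)"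
      using \<nu>(1) by (intro emeasure_mono) (auto simp: cell_def)
    also have "\<dots> < \<infinity>" unfolding D_def by (rule \<nu>(2))
    finally show ?thesis .
  qed
  have P: "poisson_distributed M (?Z k) (measure \<nu> (cell n k))" for k
    using poisson_process_single[OF \<eta> borel_cell fin] .
  have [measurable]: "?Z k \<in> borel_measurable M" for k using P[of k] by (simp add: poisson_distributed_def)
  have ne: "?I \<noteq> {}" "finite ?I" by (auto simp: cell_indices_def)
  have eq: "?X -` {x} \<inter> space M = (\<Inter>k\<in>?I. ?Z k -` {of_nat (x k)} \<inter> space M)" if x: "x \<in> extensional ?I" for x
  proof -
    have "?X \<omega> = x \<longleftrightarrow> (\<forall>k\<in>?I. ?Z k \<omega> = of_nat (x k))" if \<omega>: "\<omega> \<in> space M" for \<omega>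
    proof -
      have "?X \<omega> = x \<longleftrightarrow> (\<forall>k\<in>?I. npoints (\<eta> \<omega>) (cell n k) = x k)"
        using x by (auto simp: cell_counts_def fun_eq_iff restrict_def extensional_def)
      then show ?thesis
        by (simp add: emeasure_npoints[OF \<eta>_conf[OF \<omega>] borel_cell bounded_cell])
    qed
    then show ?thesis using ne by auto
  qed
  show "?X -` {x} \<inter> space M \<in> events"
  proof (cases "x \<in> extensional ?I")
    case True
    show ?thesis unfolding eq[OF True] using ne by (intro sets.finite_INT) (auto intro!: measurable_sets_borel)
  next
    case False
    then have "?X -` {x} \<inter> space M = {}" by (auto simp: cell_counts_def)
    then show ?thesis by (metis sets.empty_sets)
  qed
  show "prob (?X -` {x} \<inter> space M) = poisson_weight ?I (\<lambda>k. measure \<nu> (cell n k)) x" if x: "x \<in> extensional ?I"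
  proof -
    have "indep_vars (\<lambda>_. borel) ?Z ?I"
      using \<eta> fin disjoint_cells unfolding poisson_point_process_def cell_indices_def by auto
    then have "prob (\<Inter>k\<in>?I. ?Z k -` {of_nat (x k)} \<inter> space M) = (\<Prod>k\<in>?I. prob (?Z k -` {of_nat (x k)} \<inter> space M))"
      using ne by (intro indep_varsD) auto
    also have "\<dots> = poisson_weight ?I (\<lambda>k. measure \<nu> (cell n k)) x"
      unfolding poisson_weight_def
    proof (intro prod.cong refl)
      fix k
      have "?Z k -` {of_nat (x k)} \<inter> space M = {\<omega> \<in> space M. ?Z k \<omega> = of_nat (x k)}" by auto
      then show "prob (?Z k -` {of_nat (x k)} \<inter> space M) =
          measure \<nu> (cell n k) ^ x k / fact (x k) * exp (- measure \<nu> (cell n k))"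
        using P[of k] by (simp add: poisson_distributed_def)
    qed
    finally show ?thesis using eq[OF x] by simp
  qed
qed

lemma isolating_basis_set:
  assumes \<xi>: "\<xi> \<in> configurations"
  obtains i where "x \<in> V i" "bounded (V i)" "V i \<inter> atoms \<xi> \<subseteq> {x}"
proof -
  have "finite (atoms \<xi> \<inter> cball x 1)" by (intro finite_atoms_bounded[OF \<xi>]) auto
  then obtain d where d: "0 < d" "\<And>y. y \<in> atoms \<xi> \<inter> cball x 1 \<Longrightarrow> y \<noteq> x \<Longrightarrow> d \<le> dist x y"
    using finite_set_avoid by metis
  obtain i where i: "x \<in> V i" "V i \<subseteq> ball x (min 1 d)"
    using basis_nhd[of "ball x (min 1 d)" x] d(1) by auto
  have "bounded (V i)" using bounded_subset[OF bounded_ball i(2)] .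
  moreover have "V i \<inter> atoms \<xi> \<subseteq> {x}"
  proof
    fix y assume y: "y \<in> V i \<inter> atoms \<xi>"
    then have "dist x y < min 1 d" using i(2) by auto
    then show "y \<in> {x}" using d(2)[of y] y by fastforce
  qed
  ultimately show ?thesis using that i(1) by blast
qed

text \<open>Once \<open>n\<close> exceeds the index of a basis set isolating \<open>x\<close> among
  the atoms, and \<open>x \<in> D n\<close>, the cell of \<open>x\<close> lies inside that basis
  set.\<close>

lemma cells_isolate:
  assumes \<xi>: "\<xi> \<in> configurations"
  shows "\<forall>\<^sub>F n in sequentially. x \<in> cell n (code n x) \<and> cell n (code n x) \<inter> atoms \<xi> \<subseteq> {x}
     \<and> npoints \<xi> (cell n (code n x)) = npoints \<xi> {x}"
proof -
  obtain i where i: "x \<in> V i" "bounded (V i)" "V i \<inter> atoms \<xi> \<subseteq> {x}"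
    using isolating_basis_set[OF \<xi>] .
  obtain N where N: "{x} \<subseteq> D N" using bounded_imp_subset_D[of "{x}"] by auto
  show ?thesis using eventually_ge_at_top[of "Suc (max i N)"]
  proof eventually_elim
    case (elim n)
    then have sub: "cell n (code n x) \<subseteq> V i" using i(1) by (intro cell_subset_V) auto
    have "N \<le> n" using elim by simp
    then have "x \<in> D n" using N D_mono by blast
    then have x: "x \<in> cell n (code n x)" by (simp add: cell_def)
    moreover have "cell n (code n x) \<inter> atoms \<xi> \<subseteq> {x}" using sub i(3) by blast
    ultimately show ?case using emeasure_single_atom[OF \<xi> borel_cell bounded_cell] by blast
  qed
qed

text \<open>The cells at \<open>x\<close> shrink into an isolating basis set, on which the count of
  \<open>\<zeta> m\<close> tends to the mass of \<open>\<xi>\<close> at \<open>x\<close>. Equality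
  may fail, as nearby points of \<open>\<zeta> m\<close> can sit in other cells, but an upper bound
  on the mass of \<open>\<zeta> m\<close> is what transfers distance bounds to the limit.\<close>

lemma limit_point_mass:
  assumes \<zeta>: "\<And>m::nat. \<zeta> m \<in> configurations" and \<xi>: "\<xi> \<in> configurations"
    and lim: "\<And>j. (\<lambda>m. profile (\<zeta> m) j) \<longlonglongrightarrow> profile \<xi> j" and n: "\<And>m. m \<le> n m"
  shows "\<forall>\<^sub>F m in sequentially. npoints (\<zeta> m) (cell (n m) (code (n m) x)) \<le> npoints \<xi> {x}"
proof -
  obtain i where i: "x \<in> V i" "bounded (V i)" "V i \<inter> atoms \<xi> \<subseteq> {x}"
    using isolating_basis_set[OF \<xi>] .
  obtain N where N: "V i \<subseteq> D N" using bounded_imp_subset_D[OF i(2)] .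
  then have VN: "V i \<inter> D N = V i" by auto
  have "(\<lambda>m. real (npoints (\<zeta> m) (V i))) \<longlonglongrightarrow> real (npoints \<xi> (V i))"
    using lim[of "(i, N)"] by (simp add: profile_npoints \<zeta> \<xi> VN)
  moreover have "npoints \<xi> (V i) = npoints \<xi> {x}" using i by (intro emeasure_single_atom[OF \<xi>]) auto
  ultimately have "(\<lambda>m. real (npoints (\<zeta> m) (V i))) \<longlonglongrightarrow> real (npoints \<xi> {x})" by simp
  then have "\<forall>\<^sub>F m in sequentially. real (npoints (\<zeta> m) (V i)) < real (npoints \<xi> {x}) + 1"
    by (rule order_tendstoD) simp
  then show ?thesis using eventually_ge_at_top[of "Suc i"]
  proof eventually_elim
    case (elim m)
    have "cell (n m) (code (n m) x) \<subseteq> V i"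
      using elim(2) n[of m] i(1) by (intro cell_subset_V) auto
    then have "npoints (\<zeta> m) (cell (n m) (code (n m) x)) \<le> npoints (\<zeta> m) (V i)"
      using i(2) by (intro npoints_mono[OF \<zeta>]) auto
    then show ?case using elim(1) by linarith
  qed
qed

lemma finite_atoms_D: "\<xi> \<in> configurations \<Longrightarrow> finite (atoms \<xi> \<inter> D j)"
  using finite_atoms_bounded(1)[OF _ borel_D bounded_D] .

lemma UN_atoms_D: "atoms \<xi> = (\<Union>j. atoms \<xi> \<inter> D j)"
proof -
  have "\<exists>j. x \<in> D j" for x using bounded_imp_subset_D[of "{x}"] by auto
  then show ?thesis by blast
qed

text \<open>A test function on the atoms in a fixed ball is spread over the cells once these separate the atoms.\<close>

lemma not_separated_imp_close:
  assumes \<xi>: "\<xi> \<in> configurations" and F: "finite F" "F \<subseteq> D n"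
    and iso: "\<And>x. x \<in> F \<Longrightarrow> cell n (code n x) \<inter> F \<subseteq> {x} \<and> npoints \<xi> (cell n (code n x)) = npoints \<xi> {x}"
    and g: "\<And>x. 0 \<le> g x" "(\<Sum>x\<in>F. real (npoints \<xi> {x}) * (g x)\<^sup>2) \<le> 1"
    and nsep: "\<not> count_separated (cell_indices n) r (cell_counts n ` \<A>) (cell_counts n \<xi>)"
  shows "\<exists>\<zeta>\<in>\<A>. (\<Sum>x\<in>F. g x * real (npoints \<xi> {x} - npoints \<zeta> (cell n (code n x)))) \<le> r"
proof -
  let ?I = "cell_indices n" and ?S = "\<lambda>k. {x \<in> F. code n x = k}"
  \<comment> \<open>By \<open>single\<close>, \<open>h k\<close> is the value of \<open>g\<close> at
    the only point of \<open>F\<close> in cell \<open>k\<close>, or 0 if there is none.\<close>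
  define h where "h k = sum g (?S k)" for k
  have fin: "finite ?I" by (simp add: cell_indices_def)
  have group: "(\<Sum>k\<in>?I. sum f (?S k)) = sum f F" for f :: "'a \<Rightarrow> real"
    using F(1) fin code_in_cell_indices by (intro sum.group) auto
  have single: "?S k = {x}" if "x \<in> ?S k" for k x
  proof -
    have "?S k \<subseteq> cell n (code n x) \<inter> F" using that F(2) by (auto simp: cell_def)
    then show ?thesis using that iso[of x] by auto
  qed
  have cnt: "cell_counts n \<zeta> k = npoints \<zeta> (cell n k)" if "k \<in> ?I" for \<zeta> k
    using that by (simp add: cell_counts_def)
  have sq: "real (cell_counts n \<xi> k) * (h k)\<^sup>2 = (\<Sum>x\<in>?S k. real (npoints \<xi> {x}) * (g x)\<^sup>2)" if "k \<in> ?I" for k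
  proof (cases "?S k = {}")
    case False
    then obtain x where x: "x \<in> ?S k" by blast
    then have "npoints \<xi> (cell n k) = npoints \<xi> {x}" using iso[of x] by auto
    then show ?thesis unfolding h_def single[OF x] cnt[OF that] by simp
  qed (simp add: h_def del: Collect_empty_eq)
  have diff: "h k * real (cell_counts n \<xi> k - cell_counts n \<zeta> k)
      = (\<Sum>x\<in>?S k. g x * real (npoints \<xi> {x} - npoints \<zeta> (cell n (code n x))))" if "k \<in> ?I" for k \<zeta>
  proof (cases "?S k = {}")
    case False
    then obtain x where x: "x \<in> ?S k" by blast
    then have "npoints \<xi> (cell n k) = npoints \<xi> {x}" "code n x = k" using iso[of x] by auto
    then show ?thesis unfolding h_def single[OF x] cnt[OF that] by simp
  qed (simp add: h_def del: Collect_empty_eq)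
  have "(\<Sum>k\<in>?I. real (cell_counts n \<xi> k) * (h k)\<^sup>2) \<le> 1"
    using g(2) sq group[of "\<lambda>x. real (npoints \<xi> {x}) * (g x)\<^sup>2"] by (simp cong: sum.cong)
  moreover have "0 \<le> h k" for k unfolding h_def using g(1) by (intro sum_nonneg)
  ultimately obtain \<zeta> where \<zeta>: "\<zeta> \<in> \<A>" "\<not> r < (\<Sum>k\<in>?I. h k * real (cell_counts n \<xi> k - cell_counts n \<zeta> k))"
    using nsep unfolding count_separated_def by blast
  then have "(\<Sum>k\<in>?I. h k * real (cell_counts n \<xi> k - cell_counts n \<zeta> k)) \<le> r" by simp
  then show ?thesis
    using \<zeta>(1) diff[of _ \<zeta>] group[of "\<lambda>x. g x * real (npoints \<xi> {x} - npoints \<zeta> (cell n (code n x)))"]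
    by (intro bexI[of _ \<zeta>]) (simp_all cong: sum.cong)
qed

text \<open>If separation fails for arbitrarily large \<open>n\<close>, then for each
  \<open>j\<close> some level \<open>n j \<ge> j\<close> and some \<open>\<zeta> j\<close> in
  \<open>A'\<close> have discretised difference at most \<open>r\<close> when tested with
  \<open>g\<close> on the atoms in \<open>D j\<close>. A subsequential limit \<open>\<theta>\<close>
  in \<open>A\<close> inherits the bound on every \<open>D j\<close>; letting \<open>j\<close> grow
  contradicts the choice of \<open>g\<close>.\<close>

lemma eventually_separated:
  assumes \<xi>: "\<xi> \<in> configurations" and A: "A' \<subseteq> A" "A \<subseteq> configurations" and r: "0 \<le> r"
    and cpt: "\<And>\<zeta> :: nat \<Rightarrow> 'a measure. (\<And>m. \<zeta> m \<in> A') \<Longrightarrow>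
      \<exists>\<xi>\<in>A. \<exists>r. strict_mono r \<and> (\<forall>j. (\<lambda>m. profile (\<zeta> (r m)) j) \<longlonglongrightarrow> profile \<xi> j)"
    and dist: "ennreal r < convex_dist A \<xi>"
  shows "\<forall>\<^sub>F n in sequentially. count_separated (cell_indices n) r (cell_counts n ` A') (cell_counts n \<xi>)"
proof (rule ccontr)
  assume "\<not> ?thesis"
  then have freq: "\<exists>n\<ge>N. \<not> count_separated (cell_indices n) r (cell_counts n ` A') (cell_counts n \<xi>)" for N
    by (auto simp: eventually_sequentially)
  obtain g where g: "g \<in> L2_config \<xi>" "\<And>x. 0 \<le> g x" "L2_config_norm \<xi> g \<le> 1"
    and gA: "ennreal r < (INF \<zeta>\<in>A. \<integral>\<^sup>+x. ennreal (g x) \<partial>config_diff \<xi> \<zeta>)"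
    using dist unfolding convex_dist_def less_SUP_iff by blast
  let ?F = "\<lambda>j. atoms \<xi> \<inter> D j"
  have finF: "finite (?F j)" for j using finite_atoms_D[OF \<xi>] .
  have mass: "measure \<xi> {x} = real (npoints \<xi> {x})" for x by (intro measure_npoints[OF \<xi>]) auto
  have norm: "(\<Sum>x\<in>?F j. real (npoints \<xi> {x}) * (g x)\<^sup>2) \<le> 1" for j
  proof -
    have "(\<Sum>x\<in>?F j. measure \<xi> {x} * (g x)\<^sup>2) \<le> (\<Sum>\<^sub>\<infinity>x\<in>atoms \<xi>. measure \<xi> {x} * (g x)\<^sup>2)"
      using g(1) finF by (intro finite_sum_le_infsum) (auto simp: L2_config_def)
    also have "\<dots> \<le> 1" using g(3) by (simp add: L2_config_norm_def)
    finally show ?thesis by (simp add: mass)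
  qed
  have close: "\<exists>n \<zeta>. j \<le> n \<and> \<zeta> \<in> A' \<and> (\<Sum>x\<in>?F j. g x * real (npoints \<xi> {x} - npoints \<zeta> (cell n (code n x)))) \<le> r" for j
  proof -
    have "\<forall>\<^sub>F n in sequentially. \<forall>x\<in>?F j. x \<in> cell n (code n x) \<and> cell n (code n x) \<inter> atoms \<xi> \<subseteq> {x}
     \<and> npoints \<xi> (cell n (code n x)) = npoints \<xi> {x}"
      using finF cells_isolate[OF \<xi>] by (intro eventually_ball_finite) auto
    then obtain N where N: "\<And>n x. N \<le> n \<Longrightarrow> x \<in> ?F j \<Longrightarrow> cell n (code n x) \<inter> atoms \<xi> \<subseteq> {x}
     \<and> npoints \<xi> (cell n (code n x)) = npoints \<xi> {x}" unfolding eventually_sequentially by blast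
    obtain n where n: "max N j \<le> n" "\<not> count_separated (cell_indices n) r (cell_counts n ` A') (cell_counts n \<xi>)"
      using freq by blast
    have "\<exists>\<zeta>\<in>A'. (\<Sum>x\<in>?F j. g x * real (npoints \<xi> {x} - npoints \<zeta> (cell n (code n x)))) \<le> r"
    proof (rule not_separated_imp_close[OF \<xi> finF _ _ g(2) norm n(2)])
      show "?F j \<subseteq> D n" using D_mono[of j n] n(1) by auto
      show "cell n (code n x) \<inter> ?F j \<subseteq> {x} \<and> npoints \<xi> (cell n (code n x)) = npoints \<xi> {x}" if "x \<in> ?F j" for x
        using N[of n x] n(1) that by auto
    qed
    then show ?thesis using n(1) by auto
  qed
  define P where "P j n \<zeta> \<longleftrightarrow> j \<le> n \<and> \<zeta> \<in> A' \<and>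
    (\<Sum>x\<in>?F j. g x * real (npoints \<xi> {x} - npoints \<zeta> (cell n (code n x)))) \<le> r" for j n \<zeta>
  have "\<exists>n \<zeta>. P j n \<zeta>" for j using close unfolding P_def .
  then obtain n \<zeta> where "\<And>j. P j (n j) (\<zeta> j)" by metis
  then have n: "\<And>j. j \<le> n j" and \<zeta>: "\<And>j. \<zeta> j \<in> A'"
    and le: "\<And>j. (\<Sum>x\<in>?F j. g x * real (npoints \<xi> {x} - npoints (\<zeta> j) (cell (n j) (code (n j) x)))) \<le> r"
    unfolding P_def by auto
  obtain \<theta> s where \<theta>: "\<theta> \<in> A" "strict_mono (s :: nat \<Rightarrow> nat)" "\<And>j. (\<lambda>m. profile (\<zeta> (s m)) j) \<longlonglongrightarrow> profile \<theta> j"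
    using cpt[of \<zeta>, OF \<zeta>] by blast
  have conf: "\<theta> \<in> configurations" "\<And>m. \<zeta> m \<in> configurations" using \<theta>(1) A \<zeta> by auto
  have sm: "m \<le> s m" for m using seq_suble[OF \<theta>(2)] .
  have bound: "(\<Sum>x\<in>?F j. g x * real (npoints \<xi> {x} - npoints \<theta> {x})) \<le> r" for j
  proof -
    have "m \<le> n (s m)" for m using sm[of m] n[of "s m"] by (rule order_trans)
    then have "\<forall>\<^sub>F m in sequentially. \<forall>x\<in>?F j. npoints (\<zeta> (s m)) (cell (n (s m)) (code (n (s m)) x)) \<le> npoints \<theta> {x}"
      using finF limit_point_mass[OF conf(2,1) \<theta>(3), of "\<lambda>m. n (s m)"]
      by (simp add: eventually_ball_finite)
    from eventually_conj[OF this eventually_ge_at_top[of j]]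
    obtain m where m: "j \<le> m" "\<And>x. x \<in> ?F j \<Longrightarrow> npoints (\<zeta> (s m)) (cell (n (s m)) (code (n (s m)) x)) \<le> npoints \<theta> {x}"
      using eventually_happens'[OF sequentially_bot] by blast
    \<comment> \<open>The mass of \<open>\<theta>\<close> at an atom dominates that of
      \<open>\<zeta> (s m)\<close> in its cell, so the positive parts can only grow. The sum is then
      extended to the atoms in \<open>D (s m)\<close>, where the bound for
      \<open>\<zeta> (s m)\<close> is known.\<close>
    have "(\<Sum>x\<in>?F j. g x * real (npoints \<xi> {x} - npoints \<theta> {x}))
       \<le> (\<Sum>x\<in>?F j. g x * real (npoints \<xi> {x} - npoints (\<zeta> (s m)) (cell (n (s m)) (code (n (s m)) x))))"
      using m(2) g(2) by (intro sum_mono mult_left_mono) (auto intro: diff_le_mono2)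
    also have "\<dots> \<le> (\<Sum>x\<in>?F (s m). g x * real (npoints \<xi> {x} - npoints (\<zeta> (s m)) (cell (n (s m)) (code (n (s m)) x))))"
      using D_mono[of j "s m"] m(1) sm[of m] finF g(2) by (intro sum_mono2) auto
    also have "\<dots> \<le> r" using le .
    finally show ?thesis .
  qed
  have "countable (\<Union>j. ?F j)" using finF by (intro countable_UN) (auto intro: countable_finite)
  then have count: "countable (atoms \<xi>)" by (simp only: UN_atoms_D[of \<xi>, symmetric])
  \<comment> \<open>\<open>g\<close> vanishes off the countable set of atoms, which makes it
    Borel.\<close>
  have "g \<in> borel_measurable borel"
  proof (rule measurable_discrete_difference[where X="atoms \<xi>" and f="\<lambda>_. 0"])
    show "0 = g x" if "x \<notin> atoms \<xi>" for x using g(1) that by (auto simp: L2_config_def atoms_def)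
  qed (use count in auto)
  then have "(\<integral>\<^sup>+x. ennreal (g x) \<partial>config_diff \<xi> \<theta>)
     = (\<integral>\<^sup>+x. (emeasure \<xi> {x} - emeasure \<theta> {x}) * ennreal (g x) \<partial>count_space (atoms \<xi>))"
    by (rule nn_integral_config_diff)
  also have "\<dots> \<le> ennreal r"
  proof (rule nn_integral_count_space_le[OF finF _ UN_atoms_D])
    show "incseq ?F" using D_mono by (auto simp: incseq_def)
    have "(emeasure \<xi> {x} - emeasure \<theta> {x}) * ennreal (g x) = ennreal (g x * real (npoints \<xi> {x} - npoints \<theta> {x}))" for x
    proof -
      have "emeasure \<xi> {x} - emeasure \<theta> {x} = of_nat (npoints \<xi> {x}) - of_nat (npoints \<theta> {x})"
        using emeasure_npoints[OF \<xi>, of "{x}"] emeasure_npoints[OF conf(1), of "{x}"] by simp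
      also have "\<dots> = of_nat (npoints \<xi> {x} - npoints \<theta> {x})"
        by (cases "npoints \<theta> {x} \<le> npoints \<xi> {x}")
           (auto simp: ennreal_of_nat_eq_real_of_nat ennreal_minus of_nat_diff ennreal_neg)
      finally show ?thesis using g(2)[of x] by (simp add: ennreal_mult ennreal_of_nat_eq_real_of_nat mult.commute)
    qed
    then show "(\<Sum>x\<in>?F j. (emeasure \<xi> {x} - emeasure \<theta> {x}) * ennreal (g x)) \<le> ennreal r" for j
      using bound[of j] g(2) by (simp add: sum_ennreal ennreal_leI)
  qed
  finally have "(\<integral>\<^sup>+x. ennreal (g x) \<partial>config_diff \<xi> \<theta>) \<le> ennreal r" .
  moreover have "ennreal r < (\<integral>\<^sup>+x. ennreal (g x) \<partial>config_diff \<xi> \<theta>)"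
    using gA INF_lower[OF \<theta>(1)] by (rule less_le_trans)
  ultimately show False by simp
qed

end

section \<open>The lower limit of the separation events, and the return from \<open>A'\<close> to
  \<open>A\<close>\<close>

lemma (in prob_space) vimage_extensional_nat_events:
  fixes X :: "'a \<Rightarrow> 'i \<Rightarrow> nat"
  assumes I: "finite I" and X: "\<And>x. X -` {x} \<inter> space M \<in> events" "\<And>\<omega>. \<omega> \<in> space M \<Longrightarrow> X \<omega> \<in> extensional I"
  shows "X -` S \<inter> space M \<in> events"
proof -
  have "X -` S \<inter> space M = (\<Union>x\<in>S \<inter> extensional I. X -` {x} \<inter> space M)" using X(2) by auto
  also have "\<dots> \<in> events"
    using X(1) countable_extensional_nat[OF I] by (intro sets.countable_UN'') (auto intro: countable_subset)
  finally show ?thesis .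
qed

lemma exists_counting_basis: "\<exists>V :: nat \<Rightarrow> 'a::polish_space set. counting_basis V"
proof -
  obtain B :: "'a set set" where B: "countable B" "topological_basis B"
    using ex_countable_basis by blast
  have "topological_basis (insert UNIV B)"
  proof (rule topological_basisI)
    show "open G" if "G \<in> insert UNIV B" for G using that topological_basis_open[OF B(2)] by auto
    show "\<exists>G\<in>insert UNIV B. x \<in> G \<and> G \<subseteq> U" if "open U" "x \<in> U" for U x
      by (rule topological_basisE[OF B(2) that]) blast
  qed
  moreover have "range (from_nat_into (insert UNIV B)) = insert UNIV B"
    by (rule range_from_nat_into[OF insert_not_empty countable_insert[OF B(1)]])
  ultimately have "counting_basis (from_nat_into (insert UNIV B))" by unfold_locales auto
  then show ?thesis by blast
qed

lemma (in counting_basis) concentration_of_compact_part: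
  fixes M :: "'w measure"
  assumes M: "prob_space M" and \<nu>: "sets \<nu> = sets borel" "\<And>z R. emeasure \<nu> (cball z R) < \<infinity>"
    and \<eta>: "poisson_point_process M \<nu> \<eta>" and r: "0 \<le> r"
    and A: "A' \<subseteq> A" "A \<subseteq> configurations" and meas: "{\<omega> \<in> space M. \<eta> \<omega> \<in> A'} \<in> sets M"
    and cpt: "\<And>\<zeta> :: nat \<Rightarrow> 'a measure. (\<And>m. \<zeta> m \<in> A') \<Longrightarrow>
      \<exists>\<xi>\<in>A. \<exists>r. strict_mono r \<and> (\<forall>j. (\<lambda>m. profile (\<zeta> (r m)) j) \<longlonglongrightarrow> profile \<xi> j)"
  shows "emeasure M {\<omega> \<in> space M. \<eta> \<omega> \<in> A'} * outer_measure_of M {\<omega> \<in> space M. \<eta> \<omega> \<notin> convex_enlargement A r}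
    \<le> ennreal (exp (- (r\<^sup>2 / 4)))"
proof -
  interpret prob_space M by fact
  let ?c = "exp (- (r\<^sup>2 / 4))" and ?A = "{\<omega> \<in> space M. \<eta> \<omega> \<in> A'}"
  define B where "B n = {x. count_separated (cell_indices n) r (cell_counts n ` A') x}" for n
  define X where "X n = (\<lambda>\<omega>. cell_counts n (\<eta> \<omega>))" for n
  have X: "X n -` {x} \<inter> space M \<in> events" "X n \<omega> \<in> extensional (cell_indices n)" for n x \<omega>
    unfolding X_def by (rule cell_counts_law(1)[OF M \<nu> \<eta>]) (simp add: cell_counts_def)
  have fin: "finite (cell_indices n)" for n by (simp add: cell_indices_def)
  have ev: "X n -` S \<inter> space M \<in> events" for n S
    by (rule vimage_extensional_nat_events[OF fin X])
  \<comment> \<open>Separation at every level from \<open>m\<close> on. These events increase with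
    \<open>m\<close>, and each is contained in the event at level \<open>m\<close> alone, to which
    the Poisson inequality applies.\<close>
  let ?E = "\<lambda>m. \<Inter>n\<in>{m..}. X n -` B n \<inter> space M"
  have E: "?E m \<in> events" for m using ev by (intro sets.countable_INT') auto
  have "prob ?A * prob (?E m) \<le> ?c" for m
  proof -
    have "prob ?A * prob (?E m) \<le> prob (X m -` (cell_counts m ` A') \<inter> space M) * prob (X m -` B m \<inter> space M)"
      using ev by (intro mult_mono finite_measure_mono) (auto simp: X_def)
    also have "\<dots> \<le> ?c"
      using cell_counts_law(2)[OF M \<nu> \<eta>] r
      by (intro talagrand_poisson_process[OF fin _ _ X, where m = "\<lambda>k. measure \<nu> (cell m k)"])
         (auto simp: B_def X_def)
    finally show ?thesis .
  qed
  moreover have "(\<lambda>m. prob ?A * prob (?E m)) \<longlonglongrightarrow> prob ?A * prob (\<Union>m. ?E m)"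
    using E by (intro tendsto_mult tendsto_const finite_Lim_measure_incseq) (auto simp: incseq_def)
  ultimately have le: "prob ?A * prob (\<Union>m. ?E m) \<le> ?c" by (intro LIMSEQ_le_const2) auto
  have U: "(\<Union>m. ?E m) \<in> events" using E by (intro sets.countable_UN image_subsetI)
  \<comment> \<open>Where the distance exceeds \<open>r\<close>, separation holds from some level
    on, so the union is a measurable cover that bounds the outer measure.\<close>
  have sub: "{\<omega> \<in> space M. \<eta> \<omega> \<notin> convex_enlargement A r} \<subseteq> (\<Union>m. ?E m)"
  proof
    fix \<omega> assume "\<omega> \<in> {\<omega> \<in> space M. \<eta> \<omega> \<notin> convex_enlargement A r}"
    then have \<omega>: "\<omega> \<in> space M" "\<eta> \<omega> \<notin> convex_enlargement A r" by auto
    have conf: "\<eta> \<omega> \<in> configurations"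
      using \<eta> \<omega>(1) measurable_space unfolding poisson_point_process_def
      by (metis space_configuration_space)
    then have "ennreal r < convex_dist A (\<eta> \<omega>)"
      using \<omega>(2) by (simp add: convex_enlargement_def not_le)
    from eventually_separated[OF conf A r cpt this]
    obtain N where "\<And>n. N \<le> n \<Longrightarrow> X n \<omega> \<in> B n"
      unfolding eventually_sequentially B_def X_def by blast
    then have "\<omega> \<in> ?E N" using \<omega>(1) by auto
    then show "\<omega> \<in> (\<Union>m. ?E m)" by blast
  qed
  have "outer_measure_of M {\<omega> \<in> space M. \<eta> \<omega> \<notin> convex_enlargement A r} \<le> emeasure M (\<Union>m. ?E m)"
    unfolding outer_measure_of_def by (intro INF_lower CollectI conjI U sub)
  then have "emeasure M ?A * outer_measure_of M {\<omega> \<in> space M. \<eta> \<omega> \<notin> convex_enlargement A r}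
    \<le> emeasure M ?A * emeasure M (\<Union>m. ?E m)" by (rule mult_left_mono) simp
  also have "\<dots> \<le> ennreal ?c"
    unfolding emeasure_eq_measure using le by (simp add: ennreal_mult[symmetric] ennreal_leI)
  finally show ?thesis .
qed

theorem theorem4p3:
  fixes M :: "'w measure"
    and \<nu> :: "'a::polish_space measure"
    and \<eta> :: "'w \<Rightarrow> 'a measure"
    and A :: "'a measure set"
    and r :: real
  assumes "prob_space M"
    and "sets \<nu> = sets borel"
    and "sigma_finite_measure \<nu>"
    and "\<And>z R. emeasure \<nu> (cball z R) < \<infinity>"
    and "poisson_point_process M \<nu> \<eta>"
    and "A \<in> sets configuration_space"
    and "0 \<le> r"
  shows "emeasure M {\<omega> \<in> space M. \<eta> \<omega> \<in> A} *
           outer_measure_of M {\<omega> \<in> space M. \<eta> \<omega> \<notin> convex_enlargement A r}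
         \<le> ennreal (exp (- (r\<^sup>2 / 4)))"
proof -
  interpret prob_space M by fact
  obtain V :: "nat \<Rightarrow> 'a set" where "counting_basis V" using exists_counting_basis by blast
  \<comment> \<open>Any point may serve as the centre of the balls.\<close>
  then interpret counting_basis V undefined .
  let ?a = "emeasure M {\<omega> \<in> space M. \<eta> \<omega> \<in> A}"
    and ?o = "outer_measure_of M {\<omega> \<in> space M. \<eta> \<omega> \<notin> convex_enlargement A r}"
  have o1: "?o \<le> 1"
    unfolding outer_measure_of_def emeasure_space_1[symmetric] by (intro INF_lower) auto
  have Ac: "A \<subseteq> configurations"
    using sets.sets_into_space[OF assms(6)] by (simp add: space_configuration_space)
  show ?thesis
  proof (rule ennreal_le_epsilon)
    fix \<epsilon> :: real assume "0 < \<epsilon>"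
    then obtain A' where A': "A' \<subseteq> A" "{\<omega> \<in> space M. \<eta> \<omega> \<in> A'} \<in> sets M"
      "?a \<le> emeasure M {\<omega> \<in> space M. \<eta> \<omega> \<in> A'} + ennreal \<epsilon>"
      "\<forall>\<zeta> :: nat \<Rightarrow> 'a measure. (\<forall>m. \<zeta> m \<in> A') \<longrightarrow>
        (\<exists>\<xi>\<in>A. \<exists>r. strict_mono r \<and> (\<forall>j. (\<lambda>m. profile (\<zeta> (r m)) j) \<longlonglongrightarrow> profile \<xi> j))"
      using compact_approx_configurations[OF assms(1,2,4,5,6)] by blast
    let ?a' = "emeasure M {\<omega> \<in> space M. \<eta> \<omega> \<in> A'}"
    \<comment> \<open>Since \<open>?o \<le> 1\<close>, the probability \<open>\<epsilon>\<close>
      given up with \<open>A'\<close> costs at most \<open>\<epsilon>\<close> in the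
      product.\<close>
    have "?a * ?o \<le> (?a' + ennreal \<epsilon>) * ?o" using A'(3) by (rule mult_right_mono) simp
    also have "\<dots> = ?a' * ?o + ennreal \<epsilon> * ?o" by (simp add: distrib_right)
    also have "\<dots> \<le> ennreal (exp (- (r\<^sup>2 / 4))) + ennreal \<epsilon> * 1"
      using A'(4) o1
      by (intro add_mono mult_left_mono concentration_of_compact_part[OF assms(1,2,4,5,7) A'(1) Ac A'(2)]) auto
    finally show "?a * ?o \<le> ennreal (exp (- (r\<^sup>2 / 4))) + ennreal \<epsilon>" by simp
  qed
qed

end
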